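(* Let $G,Q$ be locally compact groups and let $f:G\to Q$ be a Haagerup resolution. Then for every $X\subset G$, $(G,X)$ has relative Property (T) if and only if $\overline{f(X)}$ is compact. Accordingly, either $f$ is a proper morphism, so that $G$ is also Haagerup, or there exists a noncompact closed subset $X\subset G$ such that $(G,X)$ has relative Property (T). In particular, $G$ satisfies the TH alternative.
   Context: For a locally compact group $G$ and a subset $X\subset G$, the pair $(G,X)$ has relative Property (T) if for every net $(\varphi_i)$ of continuous normalized (i.e. $\varphi_i(1)=1$) positive definite functions on $G$ that converges to $1$ uniformly on compact subsets of $G$, the convergence is uniform on $X$. A locally compact group $G$ is Haagerup if for every compact $K\subset G$ and $\varepsilon>0$ there exists a continuous real-valued normalized positive definite function $\varphi$ on $G$, vanishing at infinity, with $\varphi|_K>1-\varepsilon$. $G$ satisfies the TH alternative if it is either Haagerup, or has a subset $X$ with noncompact closure such that $(G,X)$ has relative Property (T). A morphism between topological groups is a continuous group homomorphism; it is proper if inverse images of compact subsets are compact. Unitary representations are strongly continuous; a unitary representation $\pi$ of $G$ almost has invariant vectors if for every compact $K\subset G$ and $\varepsilon>0$ there is a nonzero vector $\xi$ with $\sup_{g\in K}\|\pi(g)\xi-\xi\|\le\varepsilon\|\xi\|$. A morphism $f:G\to Q$ with dense image between locally compact groups is a resolution if every unitary representation $\pi$ of $G$ almost having invariant vectors has a nonzero subrepresentation $\rho$ that factors as $\rho=\tilde\rho\circ f$ with $\tilde\rho$ a unitary representation of $Q$ that almost has invariant vectors (as a representation of $Q$). It is a Haagerup resolution if moreover $Q$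 is Haagerup. *)

theory Defs
  imports "HOL-Analysis.Analysis" "HOL-Algebra.Module"
begin

text \<open>
  Topological groups are types of class \<open>topological_group_add\<close>. The group law is written
  additively but is not assumed commutative, so \<open>0\<close> is the identity, \<open>g + h\<close> is the product
  $gh$ and \<open>- g\<close> is $g^{-1}$.
\<close>

section \<open>Positive definite functions\<close>

definition positive_definite :: "('g::group_add \<Rightarrow> complex) \<Rightarrow> bool" where
  "positive_definite \<phi> \<longleftrightarrow>
     (\<forall>(n::nat) (g::nat \<Rightarrow> 'g) (c::nat \<Rightarrow> complex).
        (\<Sum>i<n. \<Sum>j<n. c i * cnj (c j) * \<phi> (- g j + g i)) \<in> \<real>\<^sub>\<ge>\<^sub>0)"

definition normalized_pd :: "('g::topological_group_add \<Rightarrow> complex) \<Rightarrow> bool" where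
  "normalized_pd \<phi> \<longleftrightarrow> continuous_on UNIV \<phi> \<and> positive_definite \<phi> \<and> \<phi> 0 = 1"

text \<open>
  Nets of functions are represented by filters on the function space: a net
  corresponds to the image of its tail filter, and every filter arises in this way. This
  quantifies over nets with arbitrary index sets.
\<close>

definition relative_property_T :: "'g::topological_group_add set \<Rightarrow> bool" where
  "relative_property_T X \<longleftrightarrow>
     (\<forall>F :: ('g \<Rightarrow> complex) filter.
        eventually normalized_pd F \<longrightarrow>
        (\<forall>K. compact K \<longrightarrow> uniform_limit K (\<lambda>\<phi>. \<phi>) (\<lambda>_. 1) F) \<longrightarrow>
        uniform_limit X (\<lambda>\<phi>. \<phi>) (\<lambda>_. 1) F)"

definition vanishes_at_infinity :: "('g::topological_space \<Rightarrow> real) \<Rightarrow> bool" where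
  "vanishes_at_infinity \<phi> \<longleftrightarrow> (\<forall>e>0. \<exists>C. compact C \<and> (\<forall>g. g \<notin> C \<longrightarrow> \<bar>\<phi> g\<bar> < e))"

definition haagerup :: "'g::topological_group_add itself \<Rightarrow> bool" where
  "haagerup (_ :: 'g itself) \<longleftrightarrow>
     (\<forall>(K::'g set) \<epsilon>. compact K \<longrightarrow> \<epsilon> > 0 \<longrightarrow>
        (\<exists>\<phi> :: 'g \<Rightarrow> real.
           normalized_pd (\<lambda>g. complex_of_real (\<phi> g)) \<and>
           vanishes_at_infinity \<phi> \<and>
           (\<forall>g\<in>K. \<phi> g > 1 - \<epsilon>)))"

definition TH_alternative :: "'g::topological_group_add itself \<Rightarrow> bool" where
  "TH_alternative (_ :: 'g itself) \<longleftrightarrow>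
     haagerup TYPE('g) \<or> (\<exists>X::'g set. \<not> compact (closure X) \<and> relative_property_T X)"

section \<open>Complex Hilbert spaces\<close>

definition complex_ring :: "complex ring" where
  "complex_ring = \<lparr>carrier = UNIV, monoid.mult = (*), one = 1, zero = 0, add = (+)\<rparr>"

text \<open>
  A Hilbert space is a module with explicit carrier, so that one can quantify over all Hilbert
  spaces with vectors in a given type. The multiplicative fields inherited from the
  record of rings are not used. The inner product is linear in its first argument.
\<close>

record 'v hilbert = "(complex, 'v) module" +
  hinner :: "'v \<Rightarrow> 'v \<Rightarrow> complex"

definition hnorm :: "('v, 'm) hilbert_scheme \<Rightarrow> 'v \<Rightarrow> real" where
  "hnorm H x = sqrt (Re (hinner H x x))"

definition hdist :: "('v, 'm) hilbert_scheme \<Rightarrow> 'v \<Rightarrow> 'v \<Rightarrow> real" where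
  "hdist H x y = hnorm H (x \<ominus>\<^bsub>H\<^esub> y)"

definition htopology :: "('v, 'm) hilbert_scheme \<Rightarrow> 'v topology" where
  "htopology H = Metric_space.mtopology (carrier H) (hdist H)"

locale hilbert_space = module complex_ring H for H (structure) +
  assumes hinner_add_left:
      "\<lbrakk>x \<in> carrier H; y \<in> carrier H; z \<in> carrier H\<rbrakk>
         \<Longrightarrow> hinner H (x \<oplus> y) z = hinner H x z + hinner H y z"
    and hinner_smult_left:
      "\<lbrakk>x \<in> carrier H; y \<in> carrier H\<rbrakk> \<Longrightarrow> hinner H (a \<odot>\<^bsub>H\<^esub> x) y = a * hinner H x y"
    and hinner_commute:
      "\<lbrakk>x \<in> carrier H; y \<in> carrier H\<rbrakk> \<Longrightarrow> hinner H y x = cnj (hinner H x y)"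
    and hinner_nonneg: "x \<in> carrier H \<Longrightarrow> 0 \<le> Re (hinner H x x)"
    and hinner_definite: "\<lbrakk>x \<in> carrier H; hinner H x x = 0\<rbrakk> \<Longrightarrow> x = \<zero>\<^bsub>H\<^esub>"
    and complete: "Metric_space.mcomplete (carrier H) (hdist H)"

section \<open>Unitary representations\<close>

definition unitary_operator :: "('v, 'm) hilbert_scheme \<Rightarrow> ('v \<Rightarrow> 'v) \<Rightarrow> bool" where
  "unitary_operator H u \<longleftrightarrow>
     bij_betw u (carrier H) (carrier H) \<and>
     (\<forall>x\<in>carrier H. \<forall>y\<in>carrier H. u (x \<oplus>\<^bsub>H\<^esub> y) = u x \<oplus>\<^bsub>H\<^esub> u y) \<and>
     (\<forall>a. \<forall>x\<in>carrier H. u (a \<odot>\<^bsub>H\<^esub> x) = a \<odot>\<^bsub>H\<^esub> u x) \<and>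
     (\<forall>x\<in>carrier H. \<forall>y\<in>carrier H. hinner H (u x) (u y) = hinner H x y)"

definition unitary_rep ::
  "('v, 'm) hilbert_scheme \<Rightarrow> ('g::topological_group_add \<Rightarrow> 'v \<Rightarrow> 'v) \<Rightarrow> bool" where
  "unitary_rep H \<pi> \<longleftrightarrow>
     hilbert_space H \<and>
     (\<forall>g. unitary_operator H (\<pi> g)) \<and>
     (\<forall>g h. \<forall>x\<in>carrier H. \<pi> (g + h) x = \<pi> g (\<pi> h x)) \<and>
     (\<forall>x\<in>carrier H. continuous_map euclidean (htopology H) (\<lambda>g. \<pi> g x))"

definition almost_has_invariant_vectors ::
  "('v, 'm) hilbert_scheme \<Rightarrow> ('g::topological_group_add \<Rightarrow> 'v \<Rightarrow> 'v) \<Rightarrow> bool" where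
  "almost_has_invariant_vectors H \<pi> \<longleftrightarrow>
     (\<forall>K \<epsilon>. compact K \<longrightarrow> \<epsilon> > 0 \<longrightarrow>
        (\<exists>\<xi>\<in>carrier H. \<xi> \<noteq> \<zero>\<^bsub>H\<^esub> \<and> (\<forall>g\<in>K. hnorm H (\<pi> g \<xi> \<ominus>\<^bsub>H\<^esub> \<xi>) \<le> \<epsilon> * hnorm H \<xi>)))"

text \<open>The subrepresentation on \<open>V\<close> is \<open>\<pi>\<close> acting on the Hilbert space \<open>H\<lparr>carrier := V\<rparr>\<close>.\<close>

definition subrepresentation ::
  "('v, 'm) hilbert_scheme \<Rightarrow> ('g::topological_group_add \<Rightarrow> 'v \<Rightarrow> 'v) \<Rightarrow> 'v set \<Rightarrow> bool" where
  "subrepresentation H \<pi> V \<longleftrightarrow>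
     submodule V complex_ring H \<and> closedin (htopology H) V \<and> (\<forall>g. \<forall>x\<in>V. \<pi> g x \<in> V)"

section \<open>Morphisms and resolutions\<close>

definition morphism :: "('g::topological_group_add \<Rightarrow> 'q::topological_group_add) \<Rightarrow> bool" where
  "morphism f \<longleftrightarrow> continuous_on UNIV f \<and> (\<forall>g h. f (g + h) = f g + f h)"

definition proper_morphism ::
  "('g::topological_group_add \<Rightarrow> 'q::topological_group_add) \<Rightarrow> bool" where
  "proper_morphism f \<longleftrightarrow> morphism f \<and> (\<forall>K. compact K \<longrightarrow> compact (f -` K))"

text \<open>
  A formula cannot quantify over types, so the type \<open>'v\<close> that contains the vectors of the
  representations is a parameter. Copies of a Hilbert space inside a larger type are
  Hilbert spaces of that type, so the notion can only become more restrictive as \<open>'v\<close> grows.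
\<close>

definition resolution ::
  "'v itself \<Rightarrow> ('g::topological_group_add \<Rightarrow> 'q::topological_group_add) \<Rightarrow> bool" where
  "resolution (_ :: 'v itself) f \<longleftrightarrow>
     morphism f \<and> closure (range f) = UNIV \<and>
     (\<forall>(H :: 'v hilbert) \<pi>.
        unitary_rep H \<pi> \<and> almost_has_invariant_vectors H \<pi> \<longrightarrow>
        (\<exists>V \<rho>. subrepresentation H \<pi> V \<and> V \<noteq> {\<zero>\<^bsub>H\<^esub>} \<and>
           unitary_rep (H\<lparr>carrier := V\<rparr>) \<rho> \<and>
           almost_has_invariant_vectors (H\<lparr>carrier := V\<rparr>) \<rho> \<and>
           (\<forall>g. \<forall>x\<in>V. \<pi> g x = \<rho> (f g) x)))"

definition haagerup_resolution ::
  "'v itself \<Rightarrow> ('g::topological_group_add \<Rightarrow> 'q::topological_group_add) \<Rightarrow> bool" where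
  "haagerup_resolution (_ :: 'v itself) (f :: 'g \<Rightarrow> 'q) \<longleftrightarrow>
     resolution TYPE('v) f \<and> haagerup TYPE('q)"

text \<open>
  \<open>'v\<close> is large enough for \<open>'g\<close> if it contains a copy of the type below, in which live the
  Hilbert sums, indexed by pairs (subset of the group, natural number), of spaces of functions
  on the group.
\<close>

definition large_for :: "'v itself \<Rightarrow> 'g itself \<Rightarrow> bool" where
  "large_for (_ :: 'v itself) (_ :: 'g itself) \<longleftrightarrow>
     (\<exists>j :: ('g set \<Rightarrow> nat \<Rightarrow> 'g \<Rightarrow> complex) \<Rightarrow> 'v. inj j)"

end

theory Submission
  imports Defs
begin

text \<open>
  If \<open>(G, X)\<close> has relative Property (T), pull back to \<open>G\<close> the functions on \<open>Q\<close> that vanish at infinity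
  and are close to \<open>1\<close> on compact sets: one of them is at least \<open>1/2\<close> on \<open>f(X)\<close>.

  Conversely let \<open>f(X)\<close> be relatively compact and suppose that \<open>(G, X)\<close> does not have relative
  Property (T). Then every compact \<open>K\<close> admits a positive definite \<open>\<Phi>\<close> close to \<open>1\<close> on \<open>K\<close> and dominated
  by \<open>exp(-\<ell>\<^sup>2)\<close>, for a length function \<open>\<ell>\<close> with values in \<open>[0, \<infinity>]\<close> that takes arbitrarily large finite
  values on \<open>X\<close>. By compactness each \<open>\<ell>\<close>, and each of its conjugates, takes arbitrarily large finite values on
  \<open>f\<^sup>-\<^sup>1(W)\<close> for every identity neighbourhood \<open>W\<close>. The sum of the GNS representations of these \<open>\<Phi>\<close>
  almost has invariant vectors, so for a compact identity neighbourhood \<open>L\<close> of \<open>Q\<close> the resolution gives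
  a vector \<open>v \<noteq> 0\<close> with \<open>\<parallel>\<pi>(x) v - v\<parallel> \<le> \<parallel>v\<parallel>\<close> whenever \<open>f(x) \<in> L\<close>. Approximate \<open>v\<close> by a finite combination
  of translates of the cyclic vectors. Since \<open>f\<^sup>-\<^sup>1(L)\<close> is not covered by finitely many translates of balls
  for finitely many of the length functions, some such \<open>x\<close> makes all coefficients
  \<open>\<Phi>(h'\<^sup>-\<^sup>1 x h)\<close> that occur in \<open>\<langle>\<pi>(x) v, v\<rangle>\<close> small, which contradicts the inequality.
\<close>

section \<open>Positive definite kernels\<close>

text \<open>A list of pairs (coefficient, point) stands for a formal combination of points. Points
  may repeat, so that sums are simply concatenations.\<close>

definition form :: "('y \<Rightarrow> 'y \<Rightarrow> complex) \<Rightarrow> (complex \<times> 'y) list \<Rightarrow> (complex \<times> 'y) list \<Rightarrow> complex" where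
  "form k c d = (\<Sum>(a, y)\<leftarrow>c. \<Sum>(b, z)\<leftarrow>d. a * cnj b * k y z)"

definition pd_kernel :: "('y \<Rightarrow> 'y \<Rightarrow> complex) \<Rightarrow> bool" where
  "pd_kernel k \<longleftrightarrow> (\<forall>c. form k c c \<in> \<real>\<^sub>\<ge>\<^sub>0)"

definition scale_list :: "complex \<Rightarrow> (complex \<times> 'y) list \<Rightarrow> (complex \<times> 'y) list" where
  "scale_list s c = map (\<lambda>(a, y). (s * a, y)) c"

lemma scale_list_simps [simp]: "scale_list s [] = []" "scale_list s ((a, y) # c) = (s * a, y) # scale_list s c"
  by (auto simp: scale_list_def)

lemma form_Nil [simp]: "form k [] d = 0" "form k c [] = 0"
  by (induction c) (auto simp: form_def)

lemma form_Cons: "form k ((a, y) # c) d = a * (\<Sum>(b, z)\<leftarrow>d. cnj b * k y z) + form k c d"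
  by (simp add: form_def case_prod_unfold sum_list_const_mult mult.assoc)

lemma form_append_left [simp]: "form k (c @ c') d = form k c d + form k c' d"
  by (simp add: form_def)

lemma form_append_right [simp]: "form k c (d @ d') = form k c d + form k c d'"
  by (simp add: form_def case_prod_unfold sum_list_addf)

lemma form_Cons_right: "form k c ((b, z) # d) = cnj b * (\<Sum>(a, y)\<leftarrow>c. a * k y z) + form k c d"
  by (induction c) (auto simp: form_def algebra_simps)

lemma form_scale_list_left [simp]: "form k (scale_list s c) d = s * form k c d"
  by (induction c) (auto simp: form_Cons algebra_simps)

lemma form_scale_list_right [simp]: "form k c (scale_list s d) = cnj s * form k c d"
proof (induction d)
  case (Cons p d)
  obtain b z where [simp]: "p = (b, z)" by force
  show ?case using Cons
    by (simp add: form_Cons_right algebra_simps)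
qed auto

lemma form_singleton [simp]: "form k [(a, y)] [(b, z)] = a * cnj b * k y z"
  by (simp add: form_def)

lemma pd_kernelD:
  assumes "pd_kernel k"
  shows "Re (form k c c) \<ge> 0" "Im (form k c c) = 0"
  using assms by (auto simp: pd_kernel_def complex_nonneg_Reals_iff)

text \<open>Polarization: realness of the form at \<open>c @ d\<close> makes the imaginary parts
  opposite, and realness at \<open>c @ scale_list \<i> d\<close> makes the real parts equal.\<close>

lemma pd_kernel_form_commute:
  assumes "pd_kernel k"
  shows "form k d c = cnj (form k c d)"
proof -
  have "Im (form k (c @ d) (c @ d)) = 0" "Im (form k (c @ scale_list \<i> d) (c @ scale_list \<i> d)) = 0"
    "Im (form k c c) = 0" "Im (form k d d) = 0"
    using pd_kernelD[OF assms] by blast+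
  then show ?thesis by (auto simp: complex_eq_iff)
qed

lemma pd_kernel_commute:
  assumes "pd_kernel k"
  shows "k z y = cnj (k y z)"
  using pd_kernel_form_commute[OF assms, of "[(1, z)]" "[(1, y)]"] by simp

lemma pd_kernel_diag:
  assumes "pd_kernel k"
  shows "Re (k y y) \<ge> 0" "Im (k y y) = 0"
  using pd_kernelD[OF assms, of "[(1, y)]"] by simp_all

text \<open>The form is only semidefinite, so the case where \<open>d\<close> has norm zero is
  separated from the usual minimization.\<close>

lemma form_Cauchy_Schwarz_sq:
  assumes "pd_kernel k"
  shows "(cmod (form k c d))\<^sup>2 \<le> Re (form k c c) * Re (form k d d)"
proof -
  define x where "x = form k c d"
  define a where "a = Re (form k c c)"
  define b where "b = Re (form k d d)"
  have a: "form k c c = of_real a" "a \<ge> 0" and b: "form k d d = of_real b" "b \<ge> 0"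
    using pd_kernelD[OF assms] by (auto simp: a_def b_def complex_eq_iff)
  have xc: "form k d c = cnj x"
    using pd_kernel_form_commute[OF assms] x_def by blast
  have re: "Re (z + cnj z) = 2 * Re z" for z by simp
  have key: "0 \<le> (cmod s)\<^sup>2 * a + 2 * Re (s * cnj t * x) + (cmod t)\<^sup>2 * b" for s t
  proof -
    have "form k (scale_list s c @ scale_list t d) (scale_list s c @ scale_list t d) =
        s * cnj s * a + s * cnj t * x + cnj (s * cnj t * x) + t * cnj t * b"
      using a b xc by (simp add: x_def[symmetric] algebra_simps)
    also have "Re \<dots> = (cmod s)\<^sup>2 * a + 2 * Re (s * cnj t * x) + (cmod t)\<^sup>2 * b"
      unfolding complex_norm_square[symmetric] using re[of "s * cnj t * x"] by simp
    finally show ?thesis using pd_kernelD(1)[OF assms] by metis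
  qed
  show ?thesis
  proof (cases "b = 0")
    case True
    have "x = 0"
    proof (rule ccontr)
      assume "x \<noteq> 0"
      \<comment> \<open>For \<open>b = 0\<close> and \<open>s = 1\<close> the inequality
        \<open>key\<close> is affine in \<open>t\<close>; this multiple of \<open>x\<close> turns
        its right side into \<open>- a - 2\<close>.\<close>
      define r where "r = (a + 1) / (cmod x)\<^sup>2"
      have "0 \<le> a + 2 * Re (- of_real r * (cnj x * x))"
        using key[of 1 "- of_real r * x"] True by (simp add: algebra_simps)
      also have "\<dots> = a - 2 * (r * (cmod x)\<^sup>2)"
        unfolding complex_norm_square[symmetric] mult.commute[of "cnj x" x] by simp
      also have "r * (cmod x)\<^sup>2 = a + 1"
        using \<open>x \<noteq> 0\<close> by (simp add: r_def)
      finally show False using a by simp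
    qed
    then show ?thesis using a b by (simp add: x_def a_def b_def)
  next
    case False
    have "0 \<le> b\<^sup>2 * a + 2 * Re (- of_real b * (x * cnj x)) + (cmod x)\<^sup>2 * b"
      using key[of "of_real b" "- x"] by (simp add: algebra_simps)
    also have "\<dots> = b * (a * b - (cmod x)\<^sup>2)"
      unfolding complex_norm_square[symmetric] by (simp add: algebra_simps power2_eq_square)
    finally have "(cmod x)\<^sup>2 \<le> a * b" using False b by (simp add: zero_le_mult_iff)
    then show ?thesis unfolding x_def a_def b_def .
  qed
qed

definition form_norm :: "('y \<Rightarrow> 'y \<Rightarrow> complex) \<Rightarrow> (complex \<times> 'y) list \<Rightarrow> real" where
  "form_norm k c = sqrt (Re (form k c c))"

lemma form_norm_nonneg [simp]: "pd_kernel k \<Longrightarrow> 0 \<le> form_norm k c"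
  by (simp add: form_norm_def pd_kernelD)

lemma form_norm_sq: "pd_kernel k \<Longrightarrow> form k c c = of_real ((form_norm k c)\<^sup>2)"
  by (simp add: form_norm_def pd_kernelD complex_eq_iff)

lemma form_Cauchy_Schwarz:
  assumes "pd_kernel k"
  shows "cmod (form k c d) \<le> form_norm k c * form_norm k d"
proof -
  have "cmod (form k c d) = sqrt ((cmod (form k c d))\<^sup>2)" by simp
  also have "\<dots> \<le> sqrt (Re (form k c c) * Re (form k d d))"
    using form_Cauchy_Schwarz_sq[OF assms] real_sqrt_le_mono by blast
  finally show ?thesis by (simp add: form_norm_def real_sqrt_mult)
qed

lemma form_norm_append_le:
  assumes "pd_kernel k"
  shows "form_norm k (c @ d) \<le> form_norm k c + form_norm k d"
proof (rule power2_le_imp_le)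
  have "complex_of_real ((form_norm k (c @ d))\<^sup>2) = of_real ((form_norm k c)\<^sup>2) + form k c d + cnj (form k c d) + of_real ((form_norm k d)\<^sup>2)"
    unfolding form_norm_sq[OF assms, symmetric] using pd_kernel_form_commute[OF assms, of d c] by simp
  then have "(form_norm k (c @ d))\<^sup>2 = (form_norm k c)\<^sup>2 + 2 * Re (form k c d) + (form_norm k d)\<^sup>2"
    by (simp add: complex_eq_iff)
  also have "\<dots> \<le> (form_norm k c + form_norm k d)\<^sup>2"
    using order_trans[OF complex_Re_le_cmod form_Cauchy_Schwarz[OF assms, of c d]]
    by (simp add: power2_sum)
  finally show "(form_norm k (c @ d))\<^sup>2 \<le> (form_norm k c + form_norm k d)\<^sup>2" .
qed (use assms in auto)

section \<open>Sums, Schur products, conjugates and limits of kernels\<close>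

lemma form_cong:
  assumes "\<And>y z. y \<in> snd ` set c \<Longrightarrow> z \<in> snd ` set d \<Longrightarrow> k y z = k' y z"
  shows "form k c d = form k' c d"
  unfolding form_def
  by (intro arg_cong[of _ _ sum_list] map_cong refl) (use assms in \<open>force intro!: arg_cong[of _ _ sum_list] map_cong\<close>)

lemma form_add_kernel: "form (\<lambda>y z. k y z + k' y z) c d = form k c d + form k' c d"
  by (simp add: form_def case_prod_unfold sum_list_addf algebra_simps)

lemma form_cmult_kernel: "form (\<lambda>y z. s * k y z) c d = s * form k c d"
proof -
  have "(\<Sum>(b, z)\<leftarrow>d. a * cnj b * (s * k y z)) = s * (\<Sum>(b, z)\<leftarrow>d. a * cnj b * k y z)" for a y
    by (induction d) (auto simp: algebra_simps)
  then show ?thesis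
    by (induction c) (auto simp: form_def algebra_simps)
qed

lemma form_twist:
  "form (\<lambda>y z. u y * cnj (u z) * k y z) c d = form k (map (\<lambda>(a, y). (a * u y, y)) c) (map (\<lambda>(a, y). (a * u y, y)) d)"
  by (simp add: form_def case_prod_unfold o_def algebra_simps)

lemma form_filter:
  assumes "\<And>y z. \<not> P y \<or> \<not> P z \<Longrightarrow> k y z = 0"
  shows "form k c d = form k (filter (P \<circ> snd) c) (filter (P \<circ> snd) d)"
proof -
  have 1: "(\<Sum>(b, z)\<leftarrow>d. a * cnj b * k y z) = (\<Sum>(b, z)\<leftarrow>filter (P \<circ> snd) d. a * cnj b * k y z)" for a y d
    by (induction d) (auto simp: assms)
  have "form k c d = form k (filter (P \<circ> snd) c) d" 
    by (induction c) (auto simp: form_def assms case_prod_unfold)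
  also have "(\<lambda>(a, y). \<Sum>(b, z)\<leftarrow>d. a * cnj b * k y z) =
      (\<lambda>(a, y). \<Sum>(b, z)\<leftarrow>filter (P \<circ> snd) d. a * cnj b * k y z)"
    using 1 by (intro ext) (simp only: case_prod_unfold)
  then have "form k (filter (P \<circ> snd) c) d = form k (filter (P \<circ> snd) c) (filter (P \<circ> snd) d)"
    by (simp only: form_def)
  finally show ?thesis .
qed

text \<open>Schur product theorem, by induction on a finite set of points carrying the list. A rank
  one kernel is split off from \<open>k1\<close> so that the remainder vanishes at one point, and
  multiplying \<open>k2\<close> by a rank one kernel merely rescales the coefficients of the
  list.\<close>

lemma pd_kernel_mult:
  assumes k1: "pd_kernel k1" and k2: "pd_kernel k2"
  shows "pd_kernel (\<lambda>y z. k1 y z * k2 y z)"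
proof -
  \<comment> \<open>The kernel varies along the induction, since the elimination passes to a
    different one.\<close>
  have "form (\<lambda>y z. k1 y z * k2 y z) c c \<in> \<real>\<^sub>\<ge>\<^sub>0" if "finite I" "snd ` set c \<subseteq> I" "pd_kernel k1" for I c k1
    using that
  proof (induction I arbitrary: c k1 rule: finite_induct)
    case empty
    then show ?case by auto
  next
    case (insert y I)
    \<comment> \<open>A vanishing diagonal entry kills its row and column by Cauchy-Schwarz, so
      \<open>y\<close> can be removed from the list and the induction hypothesis applies.\<close>
    have van: "form (\<lambda>y z. k y z * k2 y z) c c \<in> \<real>\<^sub>\<ge>\<^sub>0" if k: "pd_kernel k" and y: "k y y = 0" for k
    proof -
      have row: "k y z = 0" for z
        using form_Cauchy_Schwarz_sq[OF k, of "[(1, y)]" "[(1, z)]"] y by simp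
      have col: "k z y = 0" for z
        using row pd_kernel_commute[OF k] by (metis complex_cnj_zero)
      have "form (\<lambda>y z. k y z * k2 y z) c c =
        form (\<lambda>y z. k y z * k2 y z) (filter ((\<lambda>z. z \<noteq> y) \<circ> snd) c) (filter ((\<lambda>z. z \<noteq> y) \<circ> snd) c)"
        by (rule form_filter) (auto simp: row col)
      also have "\<dots> \<in> \<real>\<^sub>\<ge>\<^sub>0"
        using insert.prems by (intro insert.IH k) auto
      finally show ?thesis .
    qed
    show ?case
    proof (cases "k1 y y = 0")
      case True
      then show ?thesis using van insert.prems by blast
    next
      case False
      note pd = insert.prems(2)
      define r where "r = Re (k1 y y)"
      have r: "k1 y y = of_real r" "r > 0"
        using False pd_kernel_diag[OF pd, of y] by (auto simp: r_def complex_eq_iff)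
      define u where "u z = k1 z y / of_real (sqrt r)" for z
      \<comment> \<open>One step of Cholesky elimination\<close>
      define k where "k w z = k1 w z - u w * cnj (u z)" for w z
      have ssr: "complex_of_real (sqrt r) * complex_of_real (sqrt r) = of_real r"
        using r by (simp flip: of_real_mult)
      have uu: "u w * cnj (u z) = k1 w y * k1 y z / of_real r" for w z
        using pd_kernel_commute[OF pd, of y z] ssr by (simp add: u_def)
      have "pd_kernel k"
        unfolding pd_kernel_def
      proof
        fix d
        have rank1: "form (\<lambda>w z. u w * cnj (u z)) d d = of_real ((cmod (form k1 d [(1, y)]))\<^sup>2 / r)"
        proof -
          have 1: "form k1 d [(1, y)] = (\<Sum>(a, w)\<leftarrow>d. a * k1 w y)" for d
            by (simp add: form_def case_prod_unfold)
          have 2: "form k1 [(1, y)] d' = (\<Sum>(b, z)\<leftarrow>d'. cnj b * k1 y z)" for d'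
            by (simp add: form_def case_prod_unfold)
          have "(\<Sum>(b, z)\<leftarrow>d'. a * cnj b * (k1 w y * k1 y z / of_real r)) =
              a * k1 w y * (\<Sum>(b, z)\<leftarrow>d'. cnj b * k1 y z) / of_real r" for a w d'
            by (induction d') (auto simp: add_divide_distrib distrib_left)
          then have "form (\<lambda>w z. u w * cnj (u z)) d d' = form k1 d [(1, y)] * form k1 [(1, y)] d' / of_real r" for d'
            unfolding uu 1 2
            by (induction d) (auto simp: form_def add_divide_distrib distrib_right)
          then show ?thesis
            using pd_kernel_form_commute[OF pd, of "[(1, y)]" d] by (simp flip: complex_norm_square)
        qed
        have "form k d d + form (\<lambda>w z. u w * cnj (u z)) d d = form k1 d d"
          unfolding form_add_kernel[symmetric] by (simp add: k_def)
        then have *: "form k d d = form k1 d d - of_real ((cmod (form k1 d [(1, y)]))\<^sup>2 / r)"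
          unfolding rank1 by (simp add: algebra_simps)
        have "(cmod (form k1 d [(1, y)]))\<^sup>2 \<le> Re (form k1 d d) * r"
          using form_Cauchy_Schwarz_sq[OF pd, of d "[(1, y)]"] by (simp add: r_def)
        then have "(cmod (form k1 d [(1, y)]))\<^sup>2 / r \<le> Re (form k1 d d)"
          using r by (simp add: field_simps)
        then show "form k d d \<in> \<real>\<^sub>\<ge>\<^sub>0"
          unfolding * using pd_kernelD[OF pd, of d] by (simp add: complex_nonneg_Reals_iff)
      qed
      moreover have "k y y = 0"
        using r by (simp add: k_def uu)
      ultimately have A: "form (\<lambda>y z. k y z * k2 y z) c c \<in> \<real>\<^sub>\<ge>\<^sub>0"
        using van by blast
      have B: "form (\<lambda>w z. u w * cnj (u z) * k2 w z) c c \<in> \<real>\<^sub>\<ge>\<^sub>0"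
        unfolding form_twist using k2 pd_kernel_def by blast
      have "form (\<lambda>y z. k1 y z * k2 y z) c c =
          form (\<lambda>y z. k y z * k2 y z) c c + form (\<lambda>w z. u w * cnj (u z) * k2 w z) c c"
        unfolding form_add_kernel[symmetric] by (simp add: k_def algebra_simps)
      then show ?thesis using A B by (simp add: nonneg_Reals_add_I)
    qed
  qed
  from this[of "snd ` set c" c k1 for c] show ?thesis using k1 by (simp add: pd_kernel_def)
qed

lemma pd_kernel_add: "pd_kernel k1 \<Longrightarrow> pd_kernel k2 \<Longrightarrow> pd_kernel (\<lambda>y z. k1 y z + k2 y z)"
  by (simp add: pd_kernel_def form_add_kernel nonneg_Reals_add_I)

lemma pd_kernel_cmult: "r \<ge> 0 \<Longrightarrow> pd_kernel k \<Longrightarrow> pd_kernel (\<lambda>y z. of_real r * k y z)"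
  by (simp add: pd_kernel_def form_cmult_kernel nonneg_Reals_mult_I)

lemma pd_kernel_one: "pd_kernel (\<lambda>y z. 1)"
proof -
  have "form (\<lambda>y z. 1) c d = sum_list (map fst c) * cnj (sum_list (map fst d))" for c d :: "(complex \<times> 'a) list"
  proof (induction c)
    case (Cons p c)
    have "(\<Sum>(b, z)\<leftarrow>d. fst p * cnj b * 1) = fst p * cnj (sum_list (map fst d))"
      by (induction d) (auto simp: algebra_simps)
    then show ?case using Cons by (simp add: form_def case_prod_unfold algebra_simps)
  qed (simp add: form_def)
  then show ?thesis
    by (simp add: pd_kernel_def complex_nonneg_Reals_iff flip: complex_norm_square)
qed

lemma pd_kernel_cnj:
  assumes "pd_kernel k"
  shows "pd_kernel (\<lambda>y z. cnj (k y z))"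
proof -
  have "form (\<lambda>y z. cnj (k y z)) c c = form k c' c'"
    if "c' = map (\<lambda>(a, y). (cnj a, y)) c" for c c'
  proof -
    have "form (\<lambda>y z. cnj (k y z)) c d = cnj (form k (map (\<lambda>(a, y). (cnj a, y)) c) (map (\<lambda>(a, y). (cnj a, y)) d))" for d
    proof (induction c)
      case (Cons p c)
      have "(\<Sum>(b, z)\<leftarrow>d. fst p * cnj b * cnj (k (snd p) z)) =
          cnj (\<Sum>(b, z)\<leftarrow>map (\<lambda>(a, y). (cnj a, y)) d. cnj (fst p) * cnj b * k (snd p) z)"
        by (induction d) (auto simp: algebra_simps)
      then show ?case using Cons by (simp add: form_def case_prod_unfold)
    qed (simp add: form_def)
    then show ?thesis
      using pd_kernelD(2)[OF assms, of c'] that by (simp add: complex_eq_iff)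
  qed
  then show ?thesis using assms by (simp add: pd_kernel_def)
qed

lemma pd_kernel_power: "pd_kernel k \<Longrightarrow> pd_kernel (\<lambda>y z. k y z ^ n)"
  by (induction n) (auto intro: pd_kernel_one pd_kernel_mult)

lemma pd_kernel_prod: "(\<And>i. i \<in> A \<Longrightarrow> pd_kernel (k i)) \<Longrightarrow> pd_kernel (\<lambda>y z. \<Prod>i\<in>A. k i y z)"
  by (induction A rule: infinite_finite_induct) (auto intro: pd_kernel_one pd_kernel_mult)

lemma form_tendsto:
  assumes "\<And>y z. ((\<lambda>i. k i y z) \<longlongrightarrow> k' y z) F"
  shows "((\<lambda>i. form (k i) c d) \<longlongrightarrow> form k' c d) F"
proof -
  have *: "((\<lambda>i. \<Sum>(b, z)\<leftarrow>d. a * cnj b * k i y z) \<longlongrightarrow> (\<Sum>(b, z)\<leftarrow>d. a * cnj b * k' y z)) F" for a y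
    by (induction d) (auto intro!: tendsto_intros assms)
  show ?thesis
    unfolding form_def by (induction c) (auto intro!: tendsto_intros *)
qed

lemma pd_kernel_lim:
  assumes "\<And>i. pd_kernel (k i)" "\<And>y z. ((\<lambda>i. k i y z) \<longlongrightarrow> k' y z) F" "F \<noteq> bot"
  shows "pd_kernel k'"
  unfolding pd_kernel_def
proof
  fix c
  show "form k' c c \<in> \<real>\<^sub>\<ge>\<^sub>0"
    by (rule Lim_in_closed_set[where f = "\<lambda>i. form (k i) c c" and F = F])
      (use assms in \<open>auto simp: pd_kernel_def intro: form_tendsto\<close>)
qed

section \<open>Positive definite functions\<close>

text \<open>Phrased through a kernel so that all kernel lemmas apply; it agrees with
  \<open>positive_definite\<close>, which uses indexed families instead of lists.\<close>

definition pd_fun :: "('g::group_add \<Rightarrow> complex) \<Rightarrow> bool" where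
  "pd_fun \<phi> \<longleftrightarrow> pd_kernel (\<lambda>g h. \<phi> (- h + g))"

lemma positive_definite_iff_pd_fun: "positive_definite \<phi> \<longleftrightarrow> pd_fun \<phi>"
proof -
  have *: "(\<Sum>i<n. \<Sum>j<n. c i * cnj (c j) * \<phi> (- g j + g i)) =
      form (\<lambda>g h. \<phi> (- h + g)) (map (\<lambda>i. (c i, g i)) [0..<n]) (map (\<lambda>i. (c i, g i)) [0..<n])" for n c g
    by (simp add: form_def o_def interv_sum_list_conv_sum_set_nat atLeast0LessThan)
  show ?thesis
    unfolding positive_definite_def pd_fun_def pd_kernel_def *
  proof (intro iffI allI)
    fix l :: "(complex \<times> 'a) list"
    assume *: "\<forall>n g c. form (\<lambda>g h. \<phi> (- h + g)) (map (\<lambda>i. (c i, g i)) [0..<n]) (map (\<lambda>i. (c i, g i)) [0..<n]) \<in> \<real>\<^sub>\<ge>\<^sub>0"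
    show "form (\<lambda>g h. \<phi> (- h + g)) l l \<in> \<real>\<^sub>\<ge>\<^sub>0"
      using *[rule_format, where n = "length l" and g = "\<lambda>i. snd (l ! i)" and c = "\<lambda>i. fst (l ! i)"] by (simp add: map_nth)
  qed blast
qed

section \<open>Estimates for a normalized positive definite function\<close>

context
  fixes \<phi> :: "'g::group_add \<Rightarrow> complex"
  assumes pd: "pd_fun \<phi>" and one: "\<phi> 0 = 1"
begin

lemma pd_fun_minus: "\<phi> (- g) = cnj (\<phi> g)"
  using pd_kernel_commute[of "\<lambda>g h. \<phi> (- h + g)" 0 g] pd by (simp add: pd_fun_def)

lemma pd_fun_norm_le: "cmod (\<phi> g) \<le> 1"
  using form_Cauchy_Schwarz_sq[of "\<lambda>g h. \<phi> (- h + g)" "[(1, g)]" "[(1, 0)]"] pd one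
  by (simp add: pd_fun_def abs_square_le_1)

lemma pd_fun_form_diff: "form (\<lambda>g h. \<phi> (- h + g)) [(1, g), (-1, h)] [(1, g), (-1, h)] = of_real (2 - 2 * Re (\<phi> (- h + g)))"
proof -
  have "\<phi> (- g + h) = cnj (\<phi> (- h + g))"
    using pd_fun_minus[of "- h + g"] by (simp add: minus_add)
  then show ?thesis by (simp add: form_def one complex_eq_iff)
qed

text \<open>Cauchy-Schwarz for the difference of the points \<open>g\<close> and \<open>h\<close>
  against the point \<open>0\<close>. This reduces continuity everywhere to continuity at the
  identity.\<close>

lemma pd_fun_diff_sq_le: "(cmod (\<phi> g - \<phi> h))\<^sup>2 \<le> 2 * (1 - Re (\<phi> (- h + g)))"
proof -
  have "form (\<lambda>g h. \<phi> (- h + g)) [(1, g), (-1, h)] [(1, 0)] = \<phi> g - \<phi> h"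
    by (simp add: form_def)
  then show ?thesis
    using form_Cauchy_Schwarz_sq[of "\<lambda>g h. \<phi> (- h + g)" "[(1, g), (-1, h)]" "[(1, 0)]"] pd one
    by (simp add: pd_fun_form_diff pd_fun_def)
qed

text \<open>Parallelogram law in the GNS space for the displacements of the cyclic vector by
  \<open>g\<close> and by \<open>h\<close>; the discarded square is that of
  \<open>[(1, h), (1, g), (-2, 0)]\<close>.\<close>

lemma pd_fun_parallelogram: "1 - Re (\<phi> (- g + h)) \<le> 2 * (1 - Re (\<phi> g)) + 2 * (1 - Re (\<phi> h))"
proof -
  have 1: "\<phi> (- h + g) = cnj (\<phi> (- g + h))"
    using pd_fun_minus[of "- g + h"] by (simp add: minus_add)
  have "0 \<le> Re (form (\<lambda>g h. \<phi> (- h + g)) [(1, h), (1, g), (-2, 0)] [(1, h), (1, g), (-2, 0)])"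
    using pd pd_kernelD(1) pd_fun_def by blast
  also have "\<dots> = 6 + 2 * Re (\<phi> (- g + h)) - 4 * Re (\<phi> h) - 4 * Re (\<phi> g)"
    by (simp add: form_def one 1 pd_fun_minus)
  finally show ?thesis by simp
qed

lemma pd_fun_one_diff: "(cmod (\<phi> g - 1))\<^sup>2 \<le> 2 * (1 - Re (\<phi> g))"
  using pd_fun_diff_sq_le[of g 0] one by simp

text \<open>In the application \<open>G\<close> is the neighbourhood filter of the identity, reached
  after translating by \<open>- h\<close>; the difference estimate turns convergence there into
  convergence at \<open>h\<close>.\<close>

lemma pd_fun_continuous:
  fixes G
  assumes "((\<lambda>g. Re (\<phi> g)) \<longlongrightarrow> 1) G" "filterlim (\<lambda>g. - h + g) G F"
  shows "(\<phi> \<longlongrightarrow> \<phi> h) F"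
proof -
  have "((\<lambda>g. Re (\<phi> (- h + g))) \<longlongrightarrow> 1) F"
    using filterlim_compose[OF assms] .
  then have "((\<lambda>g. sqrt (2 * (1 - Re (\<phi> (- h + g))))) \<longlongrightarrow> sqrt (2 * (1 - 1))) F"
    by (intro tendsto_intros)
  then have *: "((\<lambda>g. sqrt (2 * (1 - Re (\<phi> (- h + g))))) \<longlongrightarrow> 0) F"
    by simp
  have "cmod (\<phi> g - \<phi> h) \<le> sqrt (2 * (1 - Re (\<phi> (- h + g))))" for g
    using real_le_rsqrt[OF pd_fun_diff_sq_le] .
  then have "((\<lambda>g. \<phi> g - \<phi> h) \<longlongrightarrow> 0) F"
    by (intro Lim_null_comparison[OF _ *] always_eventually allI)
  then show ?thesis by (rule LIM_zero_cancel)
qed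

end

lemma pd_fun_add: "pd_fun \<phi> \<Longrightarrow> pd_fun \<psi> \<Longrightarrow> pd_fun (\<lambda>g. \<phi> g + \<psi> g)"
  unfolding pd_fun_def by (rule pd_kernel_add)

lemma pd_fun_one: "pd_fun (\<lambda>g. 1)"
  unfolding pd_fun_def by (rule pd_kernel_one)

text \<open>Replacing \<open>\<phi>\<close> by \<open>(1 + Re \<phi>) / 2\<close> makes it real and nonnegative, so that powers of it tend to
  \<open>0\<close> wherever it is away from \<open>1\<close>.\<close>

lemma pd_fun_half:
  assumes "pd_fun \<phi>"
  shows "pd_fun (\<lambda>g. of_real ((1 + Re (\<phi> g)) / 2))"
proof -
  have "pd_fun (\<lambda>g. cnj (\<phi> g))"
    using assms unfolding pd_fun_def by (rule pd_kernel_cnj)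
  then have "pd_fun (\<lambda>g. (\<phi> g + cnj (\<phi> g)) + 2)"
    using pd_fun_add[OF pd_fun_one pd_fun_one] assms by (intro pd_fun_add) auto
  then have "pd_kernel (\<lambda>g h. of_real (1/4) * ((\<phi> (- h + g) + cnj (\<phi> (- h + g))) + 2))"
    unfolding pd_fun_def by (rule pd_kernel_cmult[rotated]) simp
  moreover have "of_real (1/4) * ((z + cnj z) + 2) = of_real ((1 + Re z) / 2)" for z
    by (simp add: complex_eq_iff)
  ultimately show ?thesis unfolding pd_fun_def by (simp only:)
qed

text \<open>\<open>d g\<close> is a quarter of the squared displacement of the cyclic vector by
  \<open>g\<close>, which explains the triangle inequality with factor \<open>2\<close>. The last
  two bounds translate between closeness of \<open>\<phi>\<close> to \<open>1\<close> and smallness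
  of \<open>d\<close>.\<close>

lemma normalized_pd_Re_half:
  assumes "normalized_pd \<phi>"
  defines "d \<equiv> \<lambda>g. (1 - Re (\<phi> g)) / 2"
  shows "0 \<le> d g" "d g \<le> 1" "d (- g + h) \<le> 2 * d g + 2 * d h" "d 0 = 0" "continuous_on UNIV d"
    "pd_fun (\<lambda>g. of_real (1 - d g))" "(cmod (\<phi> g - 1))\<^sup>2 \<le> 4 * d g" "2 * d g \<le> cmod (\<phi> g - 1)"
proof -
  have \<phi>: "pd_fun \<phi>" "\<phi> 0 = 1" "continuous_on UNIV \<phi>"
    using assms by (auto simp: normalized_pd_def positive_definite_iff_pd_fun)
  have "\<bar>Re (\<phi> g)\<bar> \<le> 1"
    using pd_fun_norm_le[OF \<phi>(1,2)] abs_Re_le_cmod order_trans by blast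
  then show "0 \<le> d g" "d g \<le> 1" by (auto simp: d_def)
  show "d (- g + h) \<le> 2 * d g + 2 * d h"
  proof -
    have "1 - a \<le> 2 * (1 - b) + 2 * (1 - c) \<Longrightarrow> (1 - a) / 2 \<le> 2 * ((1 - b) / 2) + 2 * ((1 - c) / 2)" for a b c :: real
      by (simp add: add_divide_distrib diff_divide_distrib)
    then show ?thesis using pd_fun_parallelogram[OF \<phi>(1,2), of g h] unfolding d_def .
  qed
  show "d 0 = 0" by (simp add: d_def \<phi>)
  show "continuous_on UNIV d" unfolding d_def by (intro continuous_intros \<phi>) auto
  have "1 - d g = (1 + Re (\<phi> g)) / 2" for g by (simp add: d_def field_simps)
  then show "pd_fun (\<lambda>g. of_real (1 - d g))" using pd_fun_half[OF \<phi>(1)] by (simp only:)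
  show "(cmod (\<phi> g - 1))\<^sup>2 \<le> 4 * d g"
    using pd_fun_one_diff[OF \<phi>(1,2), of g] by (simp add: d_def)
  show "2 * d g \<le> cmod (\<phi> g - 1)"
    using complex_Re_le_cmod[of "1 - \<phi> g"] by (simp add: d_def norm_minus_commute)
qed

text \<open>\<open>B M\<close> is meant to be the set where the square of a length function, possibly infinite, is at
  most \<open>M\<close>: squaring turns the triangle inequality into the factor \<open>2\<close>.\<close>

definition length_balls :: "(real \<Rightarrow> 'g::group_add set) \<Rightarrow> bool" where
  "length_balls B \<longleftrightarrow> 0 \<in> B 0 \<and> mono B \<and>
     (\<forall>g h M M'. g \<in> B M \<longrightarrow> h \<in> B M' \<longrightarrow> - g + h \<in> B (2 * M + 2 * M'))"

text \<open>The product is compared with the weighted sum: from below by Bernoulli's inequality,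
  from above by \<open>1 - t \<le> exp (- t)\<close>. It converges because all factors lie in
  \<open>[0, 1]\<close>.\<close>

lemma power_product_bounds:
  fixes d :: "nat \<Rightarrow> real" and m :: "nat \<Rightarrow> nat"
  assumes d: "\<And>n. 0 \<le> d n" "\<And>n. d n \<le> 1"
  shows "0 \<le> (\<Prod>n<N. (1 - d n) ^ m n)" "(\<Prod>n<N. (1 - d n) ^ m n) \<le> 1"
    "1 - (\<Sum>n<N. m n * d n) \<le> (\<Prod>n<N. (1 - d n) ^ m n)"
    "(\<Prod>n<N. (1 - d n) ^ m n) \<le> exp (- (\<Sum>n<N. m n * d n))"
    "convergent (\<lambda>N. \<Prod>n<N. (1 - d n) ^ m n)"
proof -
  have q: "0 \<le> (1 - d n) ^ m n" "(1 - d n) ^ m n \<le> 1" for n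
    using d by (auto intro: power_le_one)
  show bds: "0 \<le> (\<Prod>n<N. (1 - d n) ^ m n)" "(\<Prod>n<N. (1 - d n) ^ m n) \<le> 1" for N
    using q by (auto intro: prod_nonneg prod_le_1)
  show "1 - (\<Sum>n<N. m n * d n) \<le> (\<Prod>n<N. (1 - d n) ^ m n)"
  proof (induction N)
    case (Suc N)
    define P where "P = (\<Prod>n<N. (1 - d n) ^ m n)"
    define q where "q = (1 - d N) ^ m N"
    have "1 - m N * d N \<le> q"
      using Bernoulli_inequality[of "- d N" "m N"] d[of N] by (simp add: q_def)
    \<comment> \<open>Expanded, this is \<open>P * q \<ge> P + q - 1\<close>, which makes the lower
      bounds add up.\<close>
    moreover have "0 \<le> (1 - P) * (1 - q)"
      using bds(2)[of N] q(2)[of N] unfolding P_def \<open>q = (1 - d N) ^ m N\<close> by (intro mult_nonneg_nonneg) auto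
    ultimately show ?case using Suc by (simp add: P_def[symmetric] q_def[symmetric] algebra_simps)
  qed simp
  show "(\<Prod>n<N. (1 - d n) ^ m n) \<le> exp (- (\<Sum>n<N. m n * d n))"
  proof -
    have "(\<Prod>n<N. (1 - d n) ^ m n) \<le> (\<Prod>n<N. exp (- (m n * d n)))"
    proof (intro prod_mono conjI q)
      fix n
      have "(1 - d n) ^ m n \<le> exp (- d n) ^ m n"
        using d[of n] exp_ge_add_one_self[of "- d n"] by (intro power_mono) auto
      then show "(1 - d n) ^ m n \<le> exp (- (m n * d n))"
        by (simp add: exp_of_nat_mult[symmetric])
    qed
    then show ?thesis by (simp add: exp_sum[symmetric] sum_negf)
  qed
  have "decseq (\<lambda>N. \<Prod>n<N. (1 - d n) ^ m n)"
    by (intro decseq_SucI) (use bds q in \<open>simp add: mult_left_le\<close>)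
  then obtain L where "(\<lambda>N. \<Prod>n<N. (1 - d n) ^ m n) \<longlonglongrightarrow> L"
    by (rule decseq_convergent[OF _ allI[OF bds(1)]])
  then show "convergent (\<lambda>N. \<Prod>n<N. (1 - d n) ^ m n)"
    by (rule convergentI)
qed

text \<open>One filter violates the definition, and the gap \<open>e\<close> read off from it does
  not depend on \<open>K\<close> and \<open>\<eta>\<close>: each eventual property of the filter is
  shared by some function with a bad point in \<open>X\<close>.\<close>

lemma not_relative_property_T_witness:
  assumes "\<not> relative_property_T (X :: 'g::topological_group_add set)"
  obtains e where "e > 0"
    "\<And>K \<eta>. compact K \<Longrightarrow> \<eta> > 0 \<Longrightarrow>
      \<exists>\<phi> x. normalized_pd \<phi> \<and> (\<forall>y\<in>K. cmod (\<phi> y - 1) < \<eta>) \<and> x \<in> X \<and> e \<le> cmod (\<phi> x - 1)"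
proof -
  obtain F where F: "eventually normalized_pd F" "\<And>K. compact K \<Longrightarrow> uniform_limit K (\<lambda>\<phi>. \<phi>) (\<lambda>_. 1) F"
    and nF: "\<not> uniform_limit X (\<lambda>\<phi>. \<phi>) (\<lambda>_. 1) F"
    using assms unfolding relative_property_T_def by blast
  obtain e where e: "e > 0" "\<not> (\<forall>\<^sub>F \<phi> in F. \<forall>x\<in>X. dist (\<phi> x) 1 < e)"
    using nF unfolding uniform_limit_iff by auto
  show thesis
  proof (rule that[OF e(1)])
    fix K :: "'g set" and \<eta> :: real
    assume "compact K" "\<eta> > 0"
    then have "\<forall>\<^sub>F \<phi> in F. \<forall>x\<in>K. dist (\<phi> x) 1 < \<eta>"
      using F(2) unfolding uniform_limit_iff by blast
    with F(1) have *: "\<forall>\<^sub>F \<phi> in F. normalized_pd \<phi> \<and> (\<forall>x\<in>K. dist (\<phi> x) 1 < \<eta>)"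
      by (rule eventually_conj)
    have "\<exists>\<phi>. normalized_pd \<phi> \<and> (\<forall>x\<in>K. dist (\<phi> x) 1 < \<eta>) \<and> \<not> (\<forall>x\<in>X. dist (\<phi> x) 1 < e)"
    proof (rule ccontr)
      assume "\<nexists>\<phi>. normalized_pd \<phi> \<and> (\<forall>x\<in>K. dist (\<phi> x) 1 < \<eta>) \<and> \<not> (\<forall>x\<in>X. dist (\<phi> x) 1 < e)"
      then have "\<forall>\<^sub>F \<phi> in F. \<forall>x\<in>X. dist (\<phi> x) 1 < e"
        by (intro eventually_mono[OF *]) blast
      then show False using e(2) by contradiction
    qed
    then show "\<exists>\<phi> x. normalized_pd \<phi> \<and> (\<forall>y\<in>K. cmod (\<phi> y - 1) < \<eta>) \<and> x \<in> X \<and> e \<le> cmod (\<phi> x - 1)"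
      by (auto simp: dist_norm not_less)
  qed
qed

text \<open>Here \<open>\<Phi>\<close> is the infinite product of the \<open>((1 + Re \<phi>\<^sub>n) / 2) ^ 2 ^ n\<close>, where \<open>\<phi>\<^sub>n\<close> is very close to
  \<open>1\<close> on \<open>K\<close> and at the points \<open>x\<^sub>0\<close> up to \<open>x\<^sub>n\<^sub>-\<^sub>1\<close>, but away from \<open>1\<close> at \<open>x\<^sub>n \<in> X\<close>.\<close>

lemma not_relative_property_T_profile:
  fixes X K U :: "'g::topological_group_add set"
  assumes U: "compact U" "0 \<in> interior U"
    and X: "\<not> relative_property_T X" and K: "compact K" and \<epsilon>: "\<epsilon> > 0"
  obtains \<Phi> :: "'g \<Rightarrow> real" and B where
    "normalized_pd (\<lambda>g. complex_of_real (\<Phi> g))" "\<And>g. g \<in> K \<Longrightarrow> 1 - \<Phi> g \<le> \<epsilon>" "\<And>g. 0 \<le> \<Phi> g"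
    "length_balls B" "\<And>g M. g \<notin> B M \<Longrightarrow> \<Phi> g \<le> exp (- M)" "\<And>M. \<not> X \<inter> \<Union>(range B) \<subseteq> B M"
proof -
  obtain e where e: "e > 0" and wit: "\<And>K \<eta>. compact K \<Longrightarrow> \<eta> > 0 \<Longrightarrow>
      \<exists>\<phi> x. normalized_pd \<phi> \<and> (\<forall>y\<in>K. cmod (\<phi> y - 1) < \<eta>) \<and> x \<in> X \<and> e \<le> cmod (\<phi> x - 1)"
    using not_relative_property_T_witness[OF X] by metis
  \<comment> \<open>A triple consists of the finite set \<open>A\<close> of earlier bad points, the
    current function and its bad point. The tolerance \<open>\<epsilon> / 4 ^ n\<close> absorbs the
    later exponent \<open>2 ^ n\<close> and leaves the summable \<open>\<epsilon> / 2 ^ n\<close>;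
    including \<open>U\<close> yields continuity at the identity.\<close>
  define good where "good n = (\<lambda>(A, \<phi>, x). finite A \<and> normalized_pd \<phi> \<and>
      (\<forall>y\<in>K \<union> U \<union> A. cmod (\<phi> y - 1) < \<epsilon> / 4 ^ n) \<and> x \<in> X \<and> e \<le> cmod (\<phi> x - 1))" for n
  have ex: "\<exists>\<phi> x. good n (A, \<phi>, x)" if "finite A" for n A
  proof -
    have "compact (K \<union> U \<union> A)" "\<epsilon> / 4 ^ n > 0"
      using K U that \<epsilon> by (auto intro: compact_Un finite_imp_compact)
    from wit[OF this] show ?thesis using that by (auto simp: good_def)
  qed
  have "\<exists>s. \<forall>n. good n (s n) \<and> fst (s (Suc n)) = insert (snd (snd (s n))) (fst (s n))"
  proof (rule dependent_nat_choice)
    show "\<exists>s. good 0 s" using ex[of "{}"] by blast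
    fix s n
    assume "good n s"
    then have "finite (insert (snd (snd s)) (fst s))" by (auto simp: good_def)
    from ex[OF this, of "Suc n"] obtain \<phi> x where "good (Suc n) (insert (snd (snd s)) (fst s), \<phi>, x)" by blast
    then show "\<exists>t. good (Suc n) t \<and> fst t = insert (snd (snd s)) (fst s)" by fastforce
  qed
  then obtain s where s: "\<And>n. good n (s n)" "\<And>n. fst (s (Suc n)) = insert (snd (snd (s n))) (fst (s n))"
    by blast
  define A where "A n = fst (s n)" for n
  define \<phi> where "\<phi> n = fst (snd (s n))" for n
  define x where "x n = snd (snd (s n))" for n
  have \<phi>: "normalized_pd (\<phi> n)" and near: "\<And>y. y \<in> K \<union> U \<union> A n \<Longrightarrow> cmod (\<phi> n y - 1) < \<epsilon> / 4 ^ n"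
    and x: "x n \<in> X" "e \<le> cmod (\<phi> n (x n) - 1)" for n
    using s(1)[of n] by (auto simp: good_def A_def \<phi>_def x_def case_prod_unfold)
  have A: "x k \<in> A n" if "k < n" for k n
    using that by (induction n) (auto simp: A_def x_def s(2) less_Suc_eq)

  define d where "d n g = (1 - Re (\<phi> n g)) / 2" for n g
  note d = normalized_pd_Re_half[OF \<phi>, folded d_def]
  define m where "m n = (2::nat) ^ n" for n
  \<comment> \<open>The supremum of \<open>S N g\<close> over \<open>N\<close> is the squared length
    of \<open>g\<close>, possibly infinite, and \<open>B M\<close> below is its sublevel
    set.\<close>
  define S where "S N g = (\<Sum>n<N. real (m n) * d n g)" for N g
  define P where "P N g = (\<Prod>n<N. (1 - d n g) ^ m n)" for N g
  note P = power_product_bounds[where d = "\<lambda>n. d n g" and m = m for g, OF d(1,2), folded P_def S_def]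
  define \<Phi> where "\<Phi> g = lim (\<lambda>N. P N g)" for g
  define B where "B M = {g. \<forall>N. S N g \<le> M}" for M

  have lim: "(\<lambda>N. P N g) \<longlonglongrightarrow> \<Phi> g" for g
    using P(5) by (simp add: \<Phi>_def convergent_LIMSEQ_iff)
  have nonneg: "0 \<le> \<Phi> g" for g
    by (rule LIMSEQ_le_const[OF lim]) (use P(1) in auto)
  have le1: "\<Phi> g \<le> 1" for g
    by (rule LIMSEQ_le_const2[OF lim]) (use P(2) in auto)
  have decP: "P N' g \<le> P N g" if "N \<le> N'" for N N' g
  proof (rule decseqD[OF decseq_SucI that])
    show "P (Suc n) g \<le> P n g" for n
      using P(1)[of n g] d(1,2)[of n g] by (simp add: P_def mult_left_le power_le_one)
  qed
  have le: "\<Phi> g \<le> P N g" for g N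
    by (rule LIMSEQ_le_const2[OF lim]) (use decP in auto)
  have incS: "S N g \<le> S N' g" if "N \<le> N'" for N N' g
    unfolding S_def by (rule sum_mono2) (use that d(1) in auto)
  \<comment> \<open>Stage \<open>n\<close> adds at most \<open>\<epsilon> / 2 ^ Suc n\<close> at the
    points it controls, exactly the amount by which the budget \<open>\<epsilon> / 2 ^ n\<close>
    shrinks.\<close>
  have tail: "S N' g + \<epsilon> / 2 ^ N' \<le> S N g + \<epsilon> / 2 ^ N"
    if "N \<le> N'" and g: "\<And>n. N \<le> n \<Longrightarrow> g \<in> K \<union> U \<union> A n" for N N' g
    using \<open>N \<le> N'\<close>
  proof (induction N' rule: dec_induct)
    case (step n)
    have "2 * d n g \<le> \<epsilon> / 4 ^ n"
      using d(8)[of n g] near[OF g[OF step.hyps(1)]] by linarith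
    then have "2 ^ n * (2 * d n g) \<le> 2 ^ n * (\<epsilon> / 4 ^ n)"
      by (intro mult_left_mono) auto
    also have "2 ^ n * (\<epsilon> / 4 ^ n) = \<epsilon> / 2 ^ n"
      by (simp add: field_simps flip: power_mult_distrib)
    finally have "2 * (2 ^ n * d n g) \<le> \<epsilon> / 2 ^ n" by simp
    moreover have "S (Suc n) g = S n g + 2 ^ n * d n g" by (simp add: S_def m_def)
    moreover have "2 * (\<epsilon> / 2 ^ Suc n) = \<epsilon> / 2 ^ n" by simp
    ultimately show ?case using step.IH by linarith
  qed simp
  have near_one: "1 - \<Phi> g \<le> S N g + \<epsilon> / 2 ^ N" if "g \<in> K \<union> U" for g N
  proof -
    have "1 - P n g \<le> S N g + \<epsilon> / 2 ^ N" if "n \<ge> N" for n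
    proof -
      have "S n g + \<epsilon> / 2 ^ n \<le> S N g + \<epsilon> / 2 ^ N"
        using \<open>g \<in> K \<union> U\<close> that by (intro tail) auto
      moreover have "0 \<le> \<epsilon> / 2 ^ n" using \<epsilon> by simp
      ultimately show ?thesis using P(3)[of n g] by linarith
    qed
    then show ?thesis
      by (intro LIMSEQ_le_const2[OF tendsto_diff[OF tendsto_const lim]]) blast
  qed

  have pd: "pd_fun (\<lambda>g. complex_of_real (\<Phi> g))"
    unfolding pd_fun_def
  proof (rule pd_kernel_lim[where F = sequentially])
    have "pd_kernel (\<lambda>g h. \<Prod>n<N. complex_of_real (1 - d n (- h + g)) ^ m n)" for N
      using d(6) unfolding pd_fun_def by (intro pd_kernel_prod pd_kernel_power) auto
    then show "pd_kernel (\<lambda>g h. complex_of_real (P N (- h + g)))" for N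
      by (simp add: P_def)
    show "(\<lambda>N. complex_of_real (P N (- h + g))) \<longlonglongrightarrow> complex_of_real (\<Phi> (- h + g))" for g h
      by (intro tendsto_of_real lim)
  qed auto
  have \<Phi>0: "\<Phi> 0 = 1"
  proof -
    have "P N 0 = 1" for N by (simp add: P_def d(4))
    then show ?thesis using lim[of 0] by (simp add: LIMSEQ_const_iff)
  qed
  \<comment> \<open>The tail is made small first, uniformly on \<open>U\<close>; the remaining
    finite sum is continuous and vanishes at \<open>0\<close>.\<close>
  have "(\<Phi> \<longlongrightarrow> 1) (nhds 0)"
  proof (rule tendstoI)
    fix r :: real
    assume r: "r > 0"
    have "(\<lambda>N. \<epsilon> * (1 / 2) ^ N) \<longlonglongrightarrow> \<epsilon> * 0"
      by (intro tendsto_mult tendsto_const LIMSEQ_realpow_zero) auto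
    then have "\<forall>\<^sub>F N in sequentially. \<epsilon> * (1 / 2) ^ N < r / 2"
      using r by (intro order_tendstoD) auto
    then obtain N where N: "\<epsilon> / 2 ^ N < r / 2"
      by (auto simp: eventually_sequentially power_one_over)
    have "continuous_on UNIV (S N)"
      unfolding S_def using d(5) by (intro continuous_intros) auto
    then have "(S N \<longlongrightarrow> S N 0) (nhds 0)"
      by (simp add: continuous_on_def flip: tendsto_at_iff_tendsto_nhds)
    moreover have "S N 0 = 0" by (simp add: S_def d(4))
    ultimately have "\<forall>\<^sub>F g in nhds 0. S N g < r / 2"
      using r by (intro order_tendstoD) auto
    moreover have "\<forall>\<^sub>F g in nhds 0. g \<in> U"
      using U(2) interior_subset by (auto simp: eventually_nhds intro!: exI[of _ "interior U"])
    ultimately show "\<forall>\<^sub>F g in nhds 0. dist (\<Phi> g) 1 < r"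
    proof eventually_elim
      case (elim g)
      then have "1 - \<Phi> g \<le> S N g + \<epsilon> / 2 ^ N" by (intro near_one) auto
      then have "\<bar>\<Phi> g - 1\<bar> < r" using le1[of g] N elim by linarith
      then show ?case by (simp add: dist_real_def)
    qed
  qed
  then have Re1: "((\<lambda>g. Re (complex_of_real (\<Phi> g))) \<longlongrightarrow> 1) (nhds 0)" by simp
  have "continuous_on UNIV (\<lambda>g. complex_of_real (\<Phi> g))"
    unfolding continuous_on_def
  proof
    fix h :: 'g
    have "filterlim (\<lambda>g. - h + g) (nhds (- h + h)) (at h within UNIV)"
      by (intro tendsto_intros)
    then show "((\<lambda>g. complex_of_real (\<Phi> g)) \<longlongrightarrow> complex_of_real (\<Phi> h)) (at h within UNIV)"
      using \<Phi>0 by (intro pd_fun_continuous[OF pd _ Re1]) auto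
  qed
  then have 1: "normalized_pd (\<lambda>g. complex_of_real (\<Phi> g))"
    using pd \<Phi>0 by (simp add: normalized_pd_def positive_definite_iff_pd_fun)
  have 2: "1 - \<Phi> g \<le> \<epsilon>" if "g \<in> K" for g
    using near_one[of g 0] that by (simp add: S_def)
  have 3: "length_balls B"
    unfolding length_balls_def
  proof (intro conjI allI impI monoI)
    show "0 \<in> B 0" by (simp add: B_def S_def d(4))
    show "B M \<subseteq> B M'" if "M \<le> M'" for M M'
      using that by (auto simp: B_def intro: order_trans)
    fix g h M M'
    assume gh: "g \<in> B M" "h \<in> B M'"
    have "S N (- g + h) \<le> 2 * M + 2 * M'" for N
    proof -
      have "S N (- g + h) \<le> (\<Sum>n<N. real (m n) * (2 * d n g + 2 * d n h))"
        unfolding S_def by (intro sum_mono mult_left_mono d(3)) auto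
      also have "\<dots> = 2 * S N g + 2 * S N h"
        by (simp add: S_def sum.distrib sum_distrib_left algebra_simps)
      also have "\<dots> \<le> 2 * M + 2 * M'"
        using gh by (auto simp: B_def intro!: add_mono)
      finally show ?thesis .
    qed
    then show "- g + h \<in> B (2 * M + 2 * M')" by (simp add: B_def)
  qed
  have 4: "\<Phi> g \<le> exp (- M)" if g: "g \<notin> B M" for g M
  proof -
    obtain N where "S N g > M" using g by (auto simp: B_def not_le)
    then have "exp (- S N g) \<le> exp (- M)" by simp
    then show ?thesis using le[of g N] P(4)[of N g] by linarith
  qed
  \<comment> \<open>The point \<open>x k\<close> has finite length because all later functions are
    close to \<open>1\<close> there, while stage \<open>k\<close> alone contributes at least
    \<open>2 ^ k * (e\<^sup>2 / 4)\<close>.\<close>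
  have 5: "\<not> X \<inter> \<Union>(range B) \<subseteq> B M" for M
  proof -
    obtain k where k: "M / (e\<^sup>2 / 4) < 2 ^ k"
      using real_arch_pow[of 2] by auto
    have "x k \<in> B (S (Suc k) (x k) + \<epsilon>)"
      unfolding B_def
    proof safe
      fix N
      have "S N (x k) \<le> S (max N (Suc k)) (x k)" by (intro incS) auto
      also have "S (max N (Suc k)) (x k) + \<epsilon> / 2 ^ (max N (Suc k)) \<le> S (Suc k) (x k) + \<epsilon> / 2 ^ Suc k"
        by (intro tail) (auto intro: A)
      moreover have "\<epsilon> / 2 ^ Suc k \<le> \<epsilon>"
        using \<epsilon> mult_left_mono[OF one_le_power[of "2::real" "Suc k"], of \<epsilon>]
        by (simp add: divide_le_eq del: power_Suc)
      moreover have "0 \<le> \<epsilon> / 2 ^ (max N (Suc k))"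
        using \<epsilon> by simp
      ultimately show "S N (x k) \<le> S (Suc k) (x k) + \<epsilon>" by linarith
    qed
    then have "x k \<in> X \<inter> \<Union>(range B)" using x by blast
    moreover have "x k \<notin> B M"
    proof -
      have "e\<^sup>2 \<le> (cmod (\<phi> k (x k) - 1))\<^sup>2" using x(2)[of k] e by (intro power_mono) auto
      then have "e\<^sup>2 / 4 \<le> d k (x k)" using d(7)[of k "x k"] by linarith
      have "M < 2 ^ k * (e\<^sup>2 / 4)" using k e by (simp add: field_simps)
      also have "\<dots> \<le> real (m k) * d k (x k)" unfolding m_def using \<open>e\<^sup>2 / 4 \<le> d k (x k)\<close> by simp
      also have "\<dots> \<le> S (Suc k) (x k)" using incS[of 0 k "x k"] by (simp add: S_def)
      finally show ?thesis by (auto simp: B_def not_le)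
    qed
    ultimately show ?thesis by blast
  qed
  show thesis by (rule that[OF 1 2 nonneg 3 4 5])
qed

section \<open>Coverings by translates of balls\<close>

lemma length_ballsD:
  assumes "length_balls B"
  shows "0 \<in> B 0" "M \<le> M' \<Longrightarrow> g \<in> B M \<Longrightarrow> g \<in> B M'"
    "g \<in> B M \<Longrightarrow> h \<in> B M' \<Longrightarrow> - g + h \<in> B (2 * M + 2 * M')"
  using assms by (auto simp: length_balls_def mono_def)

lemma length_balls_uminus: "length_balls B \<Longrightarrow> g \<in> B M \<Longrightarrow> - g \<in> B (2 * M)"
  using length_ballsD(3)[of B g M 0 0] length_ballsD(1)[of B] by simp

lemma length_balls_add:
  "length_balls B \<Longrightarrow> g \<in> B M \<Longrightarrow> h \<in> B M' \<Longrightarrow> g + h \<in> B (4 * M + 2 * M')"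
  using length_ballsD(3)[of B "- g" "2 * M" h M'] length_balls_uminus[of B g M] by simp

text \<open>A version of B. H. Neumann's lemma on coverings of a group by cosets. The elements of \<open>\<N>\<close> play
  the role of the group and left translates of balls that of the cosets.\<close>

lemma not_covered_by_translates:
  fixes B :: "'s \<Rightarrow> real \<Rightarrow> 'g::group_add set" and \<N> :: "'g set set"
  assumes \<N>: "\<And>N. N \<in> \<N> \<Longrightarrow> 0 \<in> N"
      "\<And>N. N \<in> \<N> \<Longrightarrow> \<exists>N'\<in>\<N>. \<forall>a\<in>N'. \<forall>b\<in>N'. a + b \<in> N \<and> - a + b \<in> N"
    and S: "finite S" "\<And>s. s \<in> S \<Longrightarrow> length_balls (B s)"
      "\<And>s N M. s \<in> S \<Longrightarrow> N \<in> \<N> \<Longrightarrow> \<not> N \<inter> \<Union>(range (B s)) \<subseteq> B s M"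
    and N: "N \<in> \<N>" and T: "finite T" "\<And>c s M. (c, s, M) \<in> T \<Longrightarrow> s \<in> S"
  shows "\<not> N \<subseteq> (\<Union>(c, s, M)\<in>T. (+) c ` B s M)"
  using S N T
proof (induction S arbitrary: N T rule: finite_induct)
  case empty
  then have "T = {}" by (auto intro: ccontr)
  then show ?case using \<N>(1)[OF empty.prems(3)] by auto
next
  case (insert s S)
  note B = insert.prems(1)[of s, simplified]
  \<comment> \<open>\<open>N'\<close> leaves room to add the base point \<open>x\<close> found
    below, and differences of elements of \<open>N''\<close> stay in \<open>N'\<close>.\<close>
  obtain N' where N': "N' \<in> \<N>" "\<And>a b. a \<in> N' \<Longrightarrow> b \<in> N' \<Longrightarrow> a + b \<in> N"
    using \<N>(2)[OF insert.prems(3)] by blast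
  obtain N'' where N'': "N'' \<in> \<N>" "\<And>a b. a \<in> N'' \<Longrightarrow> b \<in> N'' \<Longrightarrow> - a + b \<in> N'"
    using \<N>(2)[OF N'(1)] by blast
  have sub: "y \<in> N'" "y \<in> N" if "y \<in> N''" for y
    using N''(2)[OF \<N>(1)[OF N''(1)] that] N'(2)[OF \<N>(1)[OF N'(1)], of y] by auto
  show ?case
  proof
    assume cov: "N \<subseteq> (\<Union>(c, s, M)\<in>T. (+) c ` B s M)"
    define C where "C = {c. \<exists>M. (c, s, M) \<in> T}"
    have "C \<subseteq> fst ` T" unfolding C_def by force
    then have finC: "finite C" using insert.prems(4) finite_subset by blast
    define M0 where "M0 = Max (insert 0 ((\<lambda>(c, s, M). M) ` T))"
    have M0: "0 \<le> M0" "(c, t, M) \<in> T \<Longrightarrow> M \<le> M0" for c t M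
      unfolding M0_def using insert.prems(4) by (auto intro!: Max_ge rev_image_eqI)
    \<comment> \<open>Two points of one left translate of a ball of radius \<open>M0\<close> differ
      by an element of the ball of radius \<open>2 * M0 + 2 * M0\<close>.\<close>
    define R where "R = 4 * M0"
    \<comment> \<open>Otherwise every \<open>x \<in> N'\<close> of finite length would be a centre
      from \<open>C\<close> of finite length plus a bounded error, so that the finite length part of
      \<open>N'\<close> would be bounded.\<close>
    have "\<exists>x\<in>N'. \<forall>c\<in>C. \<forall>r\<in>B s R. \<forall>b\<in>B s M0. x + r \<noteq> c + b"
    proof (rule ccontr)
      assume *: "\<not> ?thesis"
      have "\<exists>L. \<forall>c\<in>C. c \<in> \<Union>(range (B s)) \<longrightarrow> c \<in> B s L"
        using finC
      proof (induction C)
        case (insert c C)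
        then obtain L where L: "\<forall>c\<in>C. c \<in> \<Union>(range (B s)) \<longrightarrow> c \<in> B s L" by blast
        show ?case
        proof (cases "c \<in> \<Union>(range (B s))")
          case True
          then obtain L' where "c \<in> B s L'" by blast
          then have "\<forall>x\<in>insert c C. x \<in> \<Union>(range (B s)) \<longrightarrow> x \<in> B s (max L L')"
            using L length_ballsD(2)[OF B] by (metis insert_iff max.cobounded1 max.cobounded2)
          then show ?thesis by blast
        next
          case False
          then show ?thesis using L by (intro exI[of _ L]) auto
        qed
      qed auto
      then obtain L where L: "\<And>c. c \<in> C \<Longrightarrow> c \<in> \<Union>(range (B s)) \<Longrightarrow> c \<in> B s L" by blast
      have "N' \<inter> \<Union>(range (B s)) \<subseteq> B s (4 * L + 2 * (4 * M0 + 2 * (2 * R)))"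
      proof
        fix x
        assume x: "x \<in> N' \<inter> \<Union>(range (B s))"
        then obtain c r b where crb: "c \<in> C" "r \<in> B s R" "b \<in> B s M0" "x + r = c + b"
          using * by blast
        have "c = (x + r) + (- b)" using crb(4) by (simp add: add.assoc)
        then have "c \<in> \<Union>(range (B s))"
          using x length_balls_add[OF B length_balls_add[OF B _ crb(2)] length_balls_uminus[OF B crb(3)]] by blast
        then have "c \<in> B s L" using L crb(1) by blast
        moreover have "b + (- r) \<in> B s (4 * M0 + 2 * (2 * R))"
          by (intro length_balls_add[OF B] length_balls_uminus[OF B] crb)
        moreover have "x = c + (b + (- r))"
          using crb(4) by (metis add.assoc add.right_inverse add.right_neutral)
        ultimately show "x \<in> B s (4 * L + 2 * (4 * M0 + 2 * (2 * R)))"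
          using length_balls_add[OF B] by blast
      qed
      then show False using insert.prems(2)[of s, OF _ N'(1)] by blast
    qed
    then obtain x where x: "x \<in> N'" "\<And>c r b. c \<in> C \<Longrightarrow> r \<in> B s R \<Longrightarrow> b \<in> B s M0 \<Longrightarrow> x + r \<noteq> c + b"
      by blast
    define T1 where "T1 = {(c, t, M). (c, t, M) \<in> T \<and> t \<noteq> s}"
    \<comment> \<open>Since \<open>x + r\<close> avoids all translates of balls for
      \<open>s\<close>, the part of the \<open>R\<close>-ball inside \<open>N'\<close> is covered by
      translates of balls for the other indices.\<close>
    have ball: "\<exists>(c, t, M)\<in>T1. r \<in> (+) (- x + c) ` B t M" if r: "r \<in> B s R" "r \<in> N'" for r
    proof -
      obtain c t M b where *: "(c, t, M) \<in> T" "b \<in> B t M" "x + r = c + b"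
        using cov N'(2)[OF x(1) r(2)] by fast
      have "t \<noteq> s"
      proof
        assume [simp]: "t = s"
        have "c \<in> C" using * by (auto simp: C_def)
        moreover have "b \<in> B s M0"
          using length_ballsD(2)[OF B M0(2)[OF *(1)]] *(2) by simp
        ultimately show False using x(2) r(1) *(3) by blast
      qed
      moreover have "r = (- x + c) + b"
        using *(3) by (metis add.assoc add.left_inverse add.left_neutral)
      ultimately show ?thesis using * by (intro bexI[of _ "(c, t, M)"]) (auto simp: T1_def)
    qed
    \<comment> \<open>\<open>p c\<close> recentres a translate at a point of \<open>N''\<close>. If
      the translate misses \<open>N''\<close>, the value is arbitrary and only adds harmless sets to
      the new cover.\<close>
    define p where "p c = (SOME y. y \<in> N'' \<and> y \<in> (+) c ` B s M0)" for c
    \<comment> \<open>Each translate for \<open>s\<close> is replaced by the cover just found, moved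
      by \<open>p c\<close>, so that only indices in \<open>S\<close> remain.\<close>
    define T' where "T' = T1 \<union> (\<lambda>(c, c', t, M). (p c - x + c', t, M)) ` (C \<times> T1)"
    have "finite T1" using insert.prems(4) by (rule rev_finite_subset) (auto simp: T1_def)
    then have fin: "finite T'" using finC by (simp add: T'_def)
    have inS: "t \<in> S" if "(c, t, M) \<in> T'" for c t M
      using that insert.prems(5) by (auto simp: T'_def T1_def)
    have "N'' \<subseteq> (\<Union>(c, s, M)\<in>T'. (+) c ` B s M)"
    proof
      fix y
      assume y: "y \<in> N''"
      then obtain c t M b where *: "(c, t, M) \<in> T" "b \<in> B t M" "y = c + b"
        using cov sub(2)[OF y] by fast
      show "y \<in> (\<Union>(c, s, M)\<in>T'. (+) c ` B s M)"
      proof (cases "t = s")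
        case False
        then have "(c, t, M) \<in> T'" using * by (auto simp: T'_def T1_def)
        then show ?thesis using * by fast
      next
        case [simp]: True
        have c: "c \<in> C" using * by (auto simp: C_def)
        have b: "b \<in> B s M0"
          using length_ballsD(2)[OF B M0(2)[OF *(1)]] *(2) by simp
        have "\<exists>y. y \<in> N'' \<and> y \<in> (+) c ` B s M0" using y b *(3) by blast
        from someI_ex[OF this] obtain b' where p: "p c \<in> N''" "p c = c + b'" "b' \<in> B s M0"
          unfolding p_def by blast
        have "- p c + y = - b' + b" by (simp add: p(2) *(3) minus_add add.assoc del: add_uminus_conv_diff)
        then have "- p c + y \<in> B s R"
          using length_ballsD(3)[OF B p(3) b] by (simp add: R_def)
        from ball[OF this N''(2)[OF p(1) y]] obtain c' t' M' b''
          where d: "(c', t', M') \<in> T1" "b'' \<in> B t' M'" "- p c + y = - x + c' + b''"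
          by fast
        have "y = (p c - x + c') + b''"
          using d(3) by (metis add.assoc add.left_neutral add.right_inverse diff_conv_add_uminus)
        moreover have "(p c - x + c', t', M') \<in> T'"
          unfolding T'_def using c d(1) by force
        ultimately show ?thesis using d(2) by fast
      qed
    qed
    moreover have "\<not> N'' \<subseteq> (\<Union>(c, s, M)\<in>T'. (+) c ` B s M)"
      using insert.prems(1,2) N''(1) fin inS by (intro insert.IH) auto
    ultimately show False by contradiction
  qed
qed

section \<open>Reproducing kernel Hilbert spaces\<close>

text \<open>By the reproducing property this is the inner product of \<open>F\<close> with
  \<open>comb k d\<close>, see \<open>rkhs_inner_comb\<close>.\<close>

definition pairing :: "('y \<Rightarrow> complex) \<Rightarrow> (complex \<times> 'y) list \<Rightarrow> complex" where
  "pairing F d = (\<Sum>(b, z)\<leftarrow>d. cnj b * F z)"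

definition comb :: "('y \<Rightarrow> 'y \<Rightarrow> complex) \<Rightarrow> (complex \<times> 'y) list \<Rightarrow> 'y \<Rightarrow> complex" where
  "comb k c z = (\<Sum>(a, y)\<leftarrow>c. a * k y z)"

text \<open>The dual norm form of the statement that \<open>F\<close> has distance at most \<open>e\<close> from \<open>comb k c\<close>; it makes
  sense before \<open>F\<close> is known to have a norm.\<close>

definition approx :: "('y \<Rightarrow> 'y \<Rightarrow> complex) \<Rightarrow> ('y \<Rightarrow> complex) \<Rightarrow> (complex \<times> 'y) list \<Rightarrow> real \<Rightarrow> bool" where
  "approx k F c e \<longleftrightarrow> (\<forall>d. cmod (pairing F d - form k c d) \<le> e * form_norm k d)"

text \<open>The completion of the span of the kernel functions, realized as a set of functions. No
  quotient by null vectors is taken, since a combination of norm zero is already the zero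
  function.\<close>

definition rkhs :: "('y \<Rightarrow> 'y \<Rightarrow> complex) \<Rightarrow> ('y \<Rightarrow> complex) set" where
  "rkhs k = {F. \<forall>e>0. \<exists>c. approx k F c e}"

definition approximant :: "('y \<Rightarrow> 'y \<Rightarrow> complex) \<Rightarrow> ('y \<Rightarrow> complex) \<Rightarrow> nat \<Rightarrow> (complex \<times> 'y) list" where
  "approximant k F n = (SOME c. approx k F c (1 / Suc n))"

text \<open>\<open>approximant\<close> is one arbitrary choice of approximations;
  \<open>rkhs_inner_tendsto\<close> shows that other choices yield the same limit.\<close>

definition rkhs_inner :: "('y \<Rightarrow> 'y \<Rightarrow> complex) \<Rightarrow> ('y \<Rightarrow> complex) \<Rightarrow> ('y \<Rightarrow> complex) \<Rightarrow> complex" where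
  "rkhs_inner k F G = lim (\<lambda>n. pairing F (approximant k G n))"

definition rkhs_norm :: "('y \<Rightarrow> 'y \<Rightarrow> complex) \<Rightarrow> ('y \<Rightarrow> complex) \<Rightarrow> real" where
  "rkhs_norm k F = sqrt (Re (rkhs_inner k F F))"

lemma pairing_simps [simp]:
  "pairing F [] = 0" "pairing F (d @ d') = pairing F d + pairing F d'" "pairing F [(b, z)] = cnj b * F z"
  "pairing F (scale_list s d) = cnj s * pairing F d"
  "pairing (\<lambda>z. F z + G z) d = pairing F d + pairing G d" "pairing (\<lambda>z. F z - G z) d = pairing F d - pairing G d"
  "pairing (\<lambda>z. s * F z) d = s * pairing F d" "pairing (\<lambda>z. - F z) d = - pairing F d" "pairing (\<lambda>z. 0) d = 0"
proof -
  show "pairing F (scale_list s d) = cnj s * pairing F d" "pairing (\<lambda>z. F z + G z) d = pairing F d + pairing G d"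
    "pairing (\<lambda>z. F z - G z) d = pairing F d - pairing G d"
    "pairing (\<lambda>z. s * F z) d = s * pairing F d" "pairing (\<lambda>z. - F z) d = - pairing F d" "pairing (\<lambda>z. 0) d = 0"
    by (induction d) (auto simp: pairing_def algebra_simps)
qed (auto simp: pairing_def)

lemma pairing_comb [simp]: "pairing (comb k c) d = form k c d"
proof (induction d)
  case (Cons p d)
  then show ?case
    by (cases p) (simp add: pairing_def form_Cons_right comb_def)
qed auto

lemma tendsto_pairing: "(\<And>z. ((\<lambda>i. F i z) \<longlongrightarrow> F' z) net) \<Longrightarrow> ((\<lambda>i. pairing (F i) d) \<longlongrightarrow> pairing F' d) net"
  by (induction d) (auto simp: pairing_def intro!: tendsto_intros)

lemma inv_Suc_tendsto: "(\<lambda>n. 1 / real (Suc n)) \<longlonglongrightarrow> 0"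
  by (rule LIMSEQ_Suc[OF lim_1_over_n])

section \<open>Inner product, norm and completeness of the reproducing kernel space\<close>

context
  fixes k :: "'y \<Rightarrow> 'y \<Rightarrow> complex"
  assumes k: "pd_kernel k"
begin

lemmas form_norm_nonneg_k [simp] = form_norm_nonneg[OF k]

lemma approxD: "approx k F c e \<Longrightarrow> cmod (pairing F d - form k c d) \<le> e * form_norm k d"
  by (simp add: approx_def)

lemma approx_comb: "approx k (comb k c) c 0"
  by (simp add: approx_def)

lemma approx_mono: "approx k F c e \<Longrightarrow> e \<le> e' \<Longrightarrow> approx k F c e'"
  unfolding approx_def by (meson order_trans mult_right_mono form_norm_nonneg_k)

lemma approx_add: "approx k F c e \<Longrightarrow> approx k G c' e' \<Longrightarrow> approx k (\<lambda>z. F z + G z) (c @ c') (e + e')"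
  unfolding approx_def
  by (auto simp: add_diff_add distrib_right intro: norm_triangle_mono)

lemma approx_scale: "approx k F c e \<Longrightarrow> approx k (\<lambda>z. s * F z) (scale_list s c) (cmod s * e)"
  unfolding approx_def
  by (auto simp: norm_mult mult.assoc intro: mult_left_mono simp flip: right_diff_distrib)

lemma rkhsI: "(\<And>e. e > 0 \<Longrightarrow> \<exists>c. approx k F c e) \<Longrightarrow> F \<in> rkhs k"
  by (simp add: rkhs_def)

lemma rkhsD: "F \<in> rkhs k \<Longrightarrow> e > 0 \<Longrightarrow> \<exists>c. approx k F c e"
  by (simp add: rkhs_def)

lemma comb_in_rkhs [simp]: "comb k c \<in> rkhs k"
  by (rule rkhsI) (use approx_mono[OF approx_comb] in \<open>auto intro: less_imp_le\<close>)

lemma rkhs_zero [simp]: "(\<lambda>z. 0) \<in> rkhs k"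
  using comb_in_rkhs[of "[]"] by (simp add: comb_def[abs_def])

lemma rkhs_add [simp]:
  assumes "F \<in> rkhs k" "G \<in> rkhs k"
  shows "(\<lambda>z. F z + G z) \<in> rkhs k"
proof (rule rkhsI)
  fix e :: real
  assume "e > 0"
  then obtain c c' where "approx k F c (e / 2)" "approx k G c' (e / 2)"
    using rkhsD[OF assms(1), of "e / 2"] rkhsD[OF assms(2), of "e / 2"] by auto
  from approx_add[OF this] show "\<exists>c. approx k (\<lambda>z. F z + G z) c e" by auto
qed

lemma rkhs_scale [simp]:
  assumes "F \<in> rkhs k"
  shows "(\<lambda>z. s * F z) \<in> rkhs k"
proof (rule rkhsI)
  fix e :: real
  assume "e > 0"
  then obtain c where "approx k F c (e / (cmod s + 1))"
    using rkhsD[OF assms, of "e / (cmod s + 1)"] by (auto simp: add_nonneg_pos)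
  from approx_scale[OF this, of s] have "approx k (\<lambda>z. s * F z) (scale_list s c) e"
    by (rule approx_mono) (use \<open>e > 0\<close> in \<open>simp add: pos_divide_le_eq add_nonneg_pos distrib_left mult.commute\<close>)
  then show "\<exists>c. approx k (\<lambda>z. s * F z) c e" by blast
qed

lemma rkhs_uminus [simp]: "F \<in> rkhs k \<Longrightarrow> (\<lambda>z. - F z) \<in> rkhs k"
  using rkhs_scale[of F "-1"] by simp

lemma rkhs_diff [simp]: "F \<in> rkhs k \<Longrightarrow> G \<in> rkhs k \<Longrightarrow> (\<lambda>z. F z - G z) \<in> rkhs k"
  using rkhs_add[of F "\<lambda>z. - G z"] by simp

lemma approx_approximant: "F \<in> rkhs k \<Longrightarrow> approx k F (approximant k F n) (1 / Suc n)"
  unfolding approximant_def by (rule someI_ex, rule rkhsD) auto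

lemma pairing_bounded:
  assumes "F \<in> rkhs k"
  obtains M where "M \<ge> 0" "\<And>d. cmod (pairing F d) \<le> M * form_norm k d"
proof -
  obtain c where c: "approx k F c 1" using rkhsD[OF assms, of 1] by auto
  have "cmod (pairing F d) \<le> (1 + form_norm k c) * form_norm k d" for d
    using norm_triangle_sub[of "pairing F d" "form k c d"] approxD[OF c, of d] form_Cauchy_Schwarz[OF k, of c d]
    by (simp add: distrib_right)
  then show thesis using that[of "1 + form_norm k c"] by simp
qed

text \<open>Both estimates are tested on the difference \<open>D\<close> of the two combinations,
  where the form is the square of the norm of \<open>D\<close>; one factor is then
  cancelled.\<close>

lemma approx_unique:
  assumes "approx k F c e" "approx k F c' e'" "0 \<le> e" "0 \<le> e'"
  shows "form_norm k (c @ scale_list (-1) c') \<le> e + e'"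
proof -
  define D where "D = c @ scale_list (-1) c'"
  have "form k D D = (pairing F D - form k c' D) - (pairing F D - form k c D)"
    by (simp add: D_def)
  then have "(form_norm k D)\<^sup>2 \<le> cmod (pairing F D - form k c' D) + cmod (pairing F D - form k c D)"
    using norm_triangle_ineq4[of "pairing F D - form k c' D" "pairing F D - form k c D"] form_norm_sq[OF k, of D]
    by (metis norm_of_real abs_of_nonneg zero_le_power2)
  also have "\<dots> \<le> (e + e') * form_norm k D"
    using approxD[OF assms(1), of D] approxD[OF assms(2), of D] by (simp add: distrib_right)
  finally have *: "form_norm k D * form_norm k D \<le> (e + e') * form_norm k D" by (simp add: power2_eq_square)
  show ?thesis
  proof (cases "form_norm k D = 0")
    case True
    then show ?thesis using assms(3,4) by (simp add: D_def)
  next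
    case False
    then have "form_norm k D > 0" using form_norm_nonneg_k[of D] by linarith
    then show ?thesis using * by (simp add: D_def)
  qed
qed

lemma pairing_diff_le:
  assumes "\<And>d. cmod (pairing F d) \<le> M * form_norm k d" "M \<ge> 0"
    and "approx k G d e" "approx k G d' e'" "0 \<le> e" "0 \<le> e'"
  shows "cmod (pairing F d - pairing F d') \<le> M * (e + e')"
proof -
  have "cmod (pairing F d - pairing F d') \<le> M * form_norm k (d @ scale_list (-1) d')"
    using assms(1)[of "d @ scale_list (-1) d'"] by simp
  also have "\<dots> \<le> M * (e + e')"
    using approx_unique[OF assms(3-6)] assms(2) by (rule mult_left_mono)
  finally show ?thesis .
qed

text \<open>A vector of the space is a bounded functional on combinations, so approximations of the
  same \<open>G\<close> give nearby values. Hence the limit exists and does not depend on the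
  approximations.\<close>

lemma rkhs_inner_tendsto:
  assumes F: "F \<in> rkhs k" and G: "G \<in> rkhs k"
    and d: "\<And>n. approx k G (d n) (e n)" "\<And>n. 0 \<le> e n" "e \<longlonglongrightarrow> 0"
  shows "(\<lambda>n. pairing F (d n)) \<longlonglongrightarrow> rkhs_inner k F G"
proof -
  obtain M where M: "M \<ge> 0" "\<And>d. cmod (pairing F d) \<le> M * form_norm k d"
    using pairing_bounded[OF F] by blast
  have "Cauchy (\<lambda>n. pairing F (approximant k G n))"
  proof (rule metric_CauchyI)
    fix r :: real
    assume "r > 0"
    have "(\<lambda>n. M * (1 / real (Suc n))) \<longlonglongrightarrow> M * 0"
      by (intro tendsto_intros inv_Suc_tendsto)
    then have "\<forall>\<^sub>F n in sequentially. M * (1 / real (Suc n)) < r / 2"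
      using \<open>r > 0\<close> by (intro order_tendstoD) auto
    then obtain N where N: "\<And>n. n \<ge> N \<Longrightarrow> M * (1 / real (Suc n)) < r / 2"
      unfolding eventually_sequentially by blast
    have "dist (pairing F (approximant k G m)) (pairing F (approximant k G n)) < r" if "m \<ge> N" "n \<ge> N" for m n
    proof -
      have "dist (pairing F (approximant k G m)) (pairing F (approximant k G n)) \<le> M * (1 / real (Suc m)) + M * (1 / real (Suc n))"
        unfolding dist_norm distrib_left[symmetric] by (rule pairing_diff_le[OF M(2,1) approx_approximant[OF G] approx_approximant[OF G]]) auto
      then show ?thesis using N[OF that(1)] N[OF that(2)] by linarith
    qed
    then show "\<exists>N. \<forall>m\<ge>N. \<forall>n\<ge>N. dist (pairing F (approximant k G m)) (pairing F (approximant k G n)) < r" by blast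
  qed
  then have *: "(\<lambda>n. pairing F (approximant k G n)) \<longlonglongrightarrow> rkhs_inner k F G"
    unfolding rkhs_inner_def by (simp add: Cauchy_convergent_iff convergent_LIMSEQ_iff)
  have "(\<lambda>n. M * (e n + 1 / real (Suc n))) \<longlonglongrightarrow> M * (0 + 0)"
    by (intro tendsto_intros inv_Suc_tendsto d)
  then have "(\<lambda>n. M * (e n + 1 / real (Suc n))) \<longlonglongrightarrow> 0" by simp
  then have "(\<lambda>n. pairing F (d n) - pairing F (approximant k G n)) \<longlonglongrightarrow> 0"
    by (rule Lim_null_comparison[rotated])
      (intro always_eventually allI pairing_diff_le[OF M(2,1) d(1) approx_approximant[OF G]] d(2), simp)
  from tendsto_add[OF this *] show ?thesis by simp
qed

lemma rkhs_inner_tendsto_approximant: "F \<in> rkhs k \<Longrightarrow> G \<in> rkhs k \<Longrightarrow> (\<lambda>n. pairing F (approximant k G n)) \<longlonglongrightarrow> rkhs_inner k F G"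
  by (rule rkhs_inner_tendsto[OF _ _ approx_approximant _ inv_Suc_tendsto]) auto

text \<open>With both arguments approximated, symmetry, positivity and translation invariance pass
  from \<open>form\<close> to the limit. The error \<open>e n\<close> is multiplied by the norm of
  \<open>d n\<close>, which stays bounded.\<close>

lemma rkhs_inner_tendsto_form:
  assumes F: "F \<in> rkhs k" and G: "G \<in> rkhs k"
    and c: "\<And>n. approx k F (c n) (e n)" "\<And>n. 0 \<le> e n" "e \<longlonglongrightarrow> 0"
    and d: "\<And>n. approx k G (d n) (e' n)" "\<And>n. 0 \<le> e' n" "e' \<longlonglongrightarrow> 0"
  shows "(\<lambda>n. form k (c n) (d n)) \<longlonglongrightarrow> rkhs_inner k F G"
proof -
  have bd: "form_norm k (d n) \<le> e' n + e' 0 + form_norm k (d 0)" for n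
  proof -
    have "form k (d n) x = form k ((d n @ scale_list (-1) (d 0)) @ d 0) x" for x by simp
    then have "form_norm k (d n) = form_norm k ((d n @ scale_list (-1) (d 0)) @ d 0)"
      by (simp add: form_norm_def)
    also have "\<dots> \<le> form_norm k (d n @ scale_list (-1) (d 0)) + form_norm k (d 0)" by (rule form_norm_append_le[OF k])
    finally show ?thesis using approx_unique[OF d(1,1,2,2), of n 0] by linarith
  qed
  have "(\<lambda>n. e n * (e' n + e' 0 + form_norm k (d 0))) \<longlonglongrightarrow> 0 * (0 + e' 0 + form_norm k (d 0))"
    by (intro tendsto_intros c d)
  then have "(\<lambda>n. e n * (e' n + e' 0 + form_norm k (d 0))) \<longlonglongrightarrow> 0" by simp
  then have "(\<lambda>n. pairing F (d n) - form k (c n) (d n)) \<longlonglongrightarrow> 0"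
    by (rule Lim_null_comparison[rotated])
      (intro always_eventually allI order_trans[OF approxD[OF c(1)] mult_left_mono[OF bd c(2)]])
  from tendsto_diff[OF rkhs_inner_tendsto[OF F G d] this] show ?thesis by simp
qed

lemma rkhs_inner_add_left:
  assumes "F \<in> rkhs k" "G \<in> rkhs k" "H \<in> rkhs k"
  shows "rkhs_inner k (\<lambda>z. F z + G z) H = rkhs_inner k F H + rkhs_inner k G H"
  using tendsto_add[OF rkhs_inner_tendsto_approximant[OF assms(1,3)] rkhs_inner_tendsto_approximant[OF assms(2,3)]]
    rkhs_inner_tendsto_approximant[OF rkhs_add[OF assms(1,2)] assms(3)] by (simp add: LIMSEQ_unique)

lemma rkhs_inner_scale_left:
  assumes "F \<in> rkhs k" "H \<in> rkhs k"
  shows "rkhs_inner k (\<lambda>z. s * F z) H = s * rkhs_inner k F H"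
  using tendsto_mult_left[OF rkhs_inner_tendsto_approximant[OF assms], of s]
    rkhs_inner_tendsto_approximant[OF rkhs_scale[OF assms(1), of s] assms(2)] by (simp add: LIMSEQ_unique)

lemma rkhs_inner_form_approximant:
  assumes "F \<in> rkhs k" "G \<in> rkhs k"
  shows "(\<lambda>n. form k (approximant k F n) (approximant k G n)) \<longlonglongrightarrow> rkhs_inner k F G"
  by (rule rkhs_inner_tendsto_form[OF assms approx_approximant[OF assms(1)] _ inv_Suc_tendsto approx_approximant[OF assms(2)] _ inv_Suc_tendsto])
    auto

lemma rkhs_inner_commute:
  assumes "F \<in> rkhs k" "G \<in> rkhs k"
  shows "rkhs_inner k G F = cnj (rkhs_inner k F G)"
proof (rule LIMSEQ_unique[OF rkhs_inner_form_approximant[OF assms(2,1)]])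
  show "(\<lambda>n. form k (approximant k G n) (approximant k F n)) \<longlonglongrightarrow> cnj (rkhs_inner k F G)"
    using tendsto_cnj[OF rkhs_inner_form_approximant[OF assms]] by (simp flip: pd_kernel_form_commute[OF k])
qed

lemma rkhs_inner_nonneg: "F \<in> rkhs k \<Longrightarrow> rkhs_inner k F F \<in> \<real>\<^sub>\<ge>\<^sub>0"
  by (rule Lim_in_closed_set[OF closed_nonneg_Reals_complex _ _ rkhs_inner_form_approximant])
    (use k in \<open>auto simp: pd_kernel_def\<close>)

lemma rkhs_norm_nonneg: "F \<in> rkhs k \<Longrightarrow> 0 \<le> rkhs_norm k F"
  using rkhs_inner_nonneg[of F] by (simp add: rkhs_norm_def complex_nonneg_Reals_iff)

lemma rkhs_inner_self: "F \<in> rkhs k \<Longrightarrow> rkhs_inner k F F = of_real ((rkhs_norm k F)\<^sup>2)"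
  using rkhs_inner_nonneg[of F] by (simp add: rkhs_norm_def complex_nonneg_Reals_iff complex_eq_iff)

lemma form_norm_approximant_tendsto:
  assumes "F \<in> rkhs k"
  shows "(\<lambda>n. form_norm k (approximant k F n)) \<longlonglongrightarrow> rkhs_norm k F"
  unfolding form_norm_def rkhs_norm_def by (intro tendsto_intros rkhs_inner_form_approximant assms)

lemma pairing_le_rkhs_norm:
  assumes "F \<in> rkhs k"
  shows "cmod (pairing F d) \<le> rkhs_norm k F * form_norm k d"
proof (rule LIMSEQ_le)
  show "(\<lambda>n. form_norm k (approximant k F n) * form_norm k d) \<longlonglongrightarrow> rkhs_norm k F * form_norm k d"
    by (intro tendsto_intros form_norm_approximant_tendsto assms)
  have "(\<lambda>n. 1 / real (Suc n) * form_norm k d) \<longlonglongrightarrow> 0 * form_norm k d"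
    by (intro tendsto_intros inv_Suc_tendsto)
  then have "(\<lambda>n. 1 / real (Suc n) * form_norm k d) \<longlonglongrightarrow> 0" by simp
  then have "(\<lambda>n. pairing F d - form k (approximant k F n) d) \<longlonglongrightarrow> 0"
    by (rule Lim_null_comparison[rotated])
      (intro always_eventually allI approxD[OF approx_approximant[OF assms]])
  from tendsto_diff[OF tendsto_const this, of "pairing F d"]
  show "(\<lambda>n. cmod (form k (approximant k F n) d)) \<longlonglongrightarrow> cmod (pairing F d)"
    by (intro tendsto_norm) simp
  show "\<exists>N. \<forall>n\<ge>N. cmod (form k (approximant k F n) d) \<le> form_norm k (approximant k F n) * form_norm k d"
    using form_Cauchy_Schwarz[OF k] by blast
qed

lemma rkhs_inner_le:
  assumes F: "F \<in> rkhs k" and G: "G \<in> rkhs k" and M: "\<And>d. cmod (pairing F d) \<le> M * form_norm k d"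
  shows "cmod (rkhs_inner k F G) \<le> M * rkhs_norm k G"
  by (rule LIMSEQ_le[OF tendsto_norm[OF rkhs_inner_tendsto_approximant[OF F G]] tendsto_mult_left[OF form_norm_approximant_tendsto[OF G]]])
    (use M in auto)

lemma rkhs_inner_Cauchy_Schwarz: "F \<in> rkhs k \<Longrightarrow> G \<in> rkhs k \<Longrightarrow> cmod (rkhs_inner k F G) \<le> rkhs_norm k F * rkhs_norm k G"
  by (rule rkhs_inner_le[OF _ _ pairing_le_rkhs_norm])


text \<open>The norm is bounded by the dual norm: the estimate is applied to approximations of
  \<open>F\<close> itself, and one factor is cancelled.\<close>

lemma rkhs_norm_le:
  assumes F: "F \<in> rkhs k" and M: "\<And>d. cmod (pairing F d) \<le> M * form_norm k d" "0 \<le> M"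
  shows "rkhs_norm k F \<le> M"
proof (cases "rkhs_norm k F = 0")
  case False
  then have pos: "rkhs_norm k F > 0" using rkhs_norm_nonneg[OF F] by linarith
  have "rkhs_norm k F * rkhs_norm k F \<le> M * rkhs_norm k F"
    using rkhs_inner_le[OF F F M(1)] rkhs_inner_self[OF F] by (simp add: power2_eq_square norm_mult)
  then show ?thesis using pos by simp
qed (use M in auto)

lemma rkhs_norm_triangle:
  assumes "F \<in> rkhs k" "G \<in> rkhs k"
  shows "rkhs_norm k (\<lambda>z. F z + G z) \<le> rkhs_norm k F + rkhs_norm k G"
proof (rule rkhs_norm_le)
  show "cmod (pairing (\<lambda>z. F z + G z) d) \<le> (rkhs_norm k F + rkhs_norm k G) * form_norm k d" for d
    using norm_triangle_mono[OF pairing_le_rkhs_norm[OF assms(1)] pairing_le_rkhs_norm[OF assms(2)]]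
    by (simp add: distrib_right)
qed (use assms rkhs_norm_nonneg in auto)

lemma rkhs_norm_uminus: 
  assumes "F \<in> rkhs k"
  shows "rkhs_norm k (\<lambda>z. - F z) = rkhs_norm k F"
proof -
  have *: "rkhs_norm k (\<lambda>z. - F z) \<le> rkhs_norm k F" if "F \<in> rkhs k" for F
    by (rule rkhs_norm_le) (use that pairing_le_rkhs_norm rkhs_norm_nonneg in auto)
  show ?thesis using *[OF assms] *[OF rkhs_uminus[OF assms]] by simp
qed

lemma rkhs_inner_comb:
  assumes "F \<in> rkhs k"
  shows "rkhs_inner k F (comb k d) = pairing F d"
  using rkhs_inner_tendsto[OF assms comb_in_rkhs approx_comb[of d]] by (simp add: LIMSEQ_const_iff)

lemma rkhs_norm_comb: "rkhs_norm k (comb k c) = form_norm k c"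
  by (simp add: rkhs_norm_def rkhs_inner_comb form_norm_def)

lemma rkhs_norm_approx:
  assumes "F \<in> rkhs k" "approx k F c e" "0 \<le> e"
  shows "rkhs_norm k (\<lambda>z. F z - comb k c z) \<le> e"
  by (rule rkhs_norm_le) (use assms approxD in auto)

lemma value_le_rkhs_norm:
  assumes "F \<in> rkhs k"
  shows "cmod (F z) \<le> rkhs_norm k F * sqrt (Re (k z z))"
  using pairing_le_rkhs_norm[OF assms, of "[(1, z)]"] by (simp add: form_norm_def)

lemma rkhs_norm_eq_0:
  assumes "F \<in> rkhs k" "rkhs_norm k F = 0"
  shows "F = (\<lambda>z. 0)"
  using value_le_rkhs_norm[OF assms(1)] assms(2) by (simp add: fun_eq_iff)

text \<open>A Cauchy sequence in norm converges pointwise. A pairing involves finitely many points,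
  so the dual norm estimates survive the pointwise limit; they place it in the space and give
  convergence in norm.\<close>

lemma rkhs_complete:
  assumes F: "\<And>n. F n \<in> rkhs k"
    and C: "\<And>e. e > 0 \<Longrightarrow> \<exists>N. \<forall>m\<ge>N. \<forall>n\<ge>N. rkhs_norm k (\<lambda>z. F m z - F n z) < e"
  obtains G where "G \<in> rkhs k" "(\<lambda>n. rkhs_norm k (\<lambda>z. F n z - G z)) \<longlonglongrightarrow> 0"
proof -
  have "Cauchy (\<lambda>n. F n z)" for z
  proof (rule metric_CauchyI)
    fix e :: real
    assume "e > 0"
    define r where "r = sqrt (Re (k z z))"
    have r: "r \<ge> 0" using pd_kernel_diag[OF k] by (simp add: r_def)
    obtain N where N: "\<forall>m\<ge>N. \<forall>n\<ge>N. rkhs_norm k (\<lambda>z. F m z - F n z) < e / (r + 1)"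
      using C[of "e / (r + 1)"] \<open>e > 0\<close> r by auto
    have "dist (F m z) (F n z) < e" if "m \<ge> N" "n \<ge> N" for m n
    proof -
      have "cmod (F m z - F n z) \<le> rkhs_norm k (\<lambda>z. F m z - F n z) * r"
        using value_le_rkhs_norm[of "\<lambda>z. F m z - F n z" z] F by (simp add: r_def)
      also have "\<dots> \<le> e / (r + 1) * r" by (rule mult_right_mono[OF less_imp_le[OF N[rule_format, OF that]] r])
      also have "\<dots> < e" using r \<open>e > 0\<close> by (simp add: field_simps)
      finally show ?thesis by (simp add: dist_norm)
    qed
    then show "\<exists>N. \<forall>m\<ge>N. \<forall>n\<ge>N. dist (F m z) (F n z) < e" by blast
  qed
  then have "convergent (\<lambda>n. F n z)" for z by (simp add: Cauchy_convergent_iff)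
  then obtain G where G: "\<And>z. (\<lambda>n. F n z) \<longlonglongrightarrow> G z"
    unfolding convergent_def by metis
  have near: "\<exists>N. \<forall>n\<ge>N. \<forall>d. cmod (pairing (\<lambda>z. F n z - G z) d) \<le> e * form_norm k d" if e: "e > 0" for e
  proof -
    obtain N where N: "\<And>m n. m \<ge> N \<Longrightarrow> n \<ge> N \<Longrightarrow> rkhs_norm k (\<lambda>z. F m z - F n z) < e"
      using C[OF e] by blast
    have "cmod (pairing (\<lambda>z. F n z - G z) d) \<le> e * form_norm k d" if "n \<ge> N" for n d
    proof (rule LIMSEQ_le_const2)
      show "(\<lambda>m. cmod (pairing (\<lambda>z. F n z - F m z) d)) \<longlonglongrightarrow> cmod (pairing (\<lambda>z. F n z - G z) d)"
        by (intro tendsto_norm tendsto_pairing tendsto_diff G tendsto_const)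
      have "cmod (pairing (\<lambda>z. F n z - F m z) d) \<le> e * form_norm k d" if "m \<ge> N" for m
        using N[OF \<open>n \<ge> N\<close> that] F
        by (intro order_trans[OF pairing_le_rkhs_norm mult_right_mono]) auto
      then show "\<exists>N. \<forall>m\<ge>N. cmod (pairing (\<lambda>z. F n z - F m z) d) \<le> e * form_norm k d" by blast
    qed
    then show ?thesis by blast
  qed
  have GE: "G \<in> rkhs k"
  proof (rule rkhsI)
    fix e :: real
    assume "e > 0"
    then obtain n where n: "\<And>d. cmod (pairing (\<lambda>z. F n z - G z) d) \<le> e / 2 * form_norm k d"
      using near[of "e / 2"] by auto
    obtain c where c: "approx k (F n) c (e / 2)" using rkhsD[OF F, of "e / 2" n] \<open>e > 0\<close> by auto
    have "approx k G c e"
      unfolding approx_def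
    proof
      fix d
      have "pairing G d - form k c d = (pairing (F n) d - form k c d) - pairing (\<lambda>z. F n z - G z) d" by simp
      then have "cmod (pairing G d - form k c d) \<le> cmod (pairing (F n) d - form k c d) + cmod (pairing (\<lambda>z. F n z - G z) d)"
        by (metis norm_triangle_ineq4)
      also have "\<dots> \<le> e / 2 * form_norm k d + e / 2 * form_norm k d"
        by (rule add_mono[OF approxD[OF c] n])
      finally show "cmod (pairing G d - form k c d) \<le> e * form_norm k d" by simp
    qed
    then show "\<exists>c. approx k G c e" by blast
  qed
  have "(\<lambda>n. rkhs_norm k (\<lambda>z. F n z - G z)) \<longlonglongrightarrow> 0"
  proof (rule LIMSEQ_I)
    fix r :: real
    assume "r > 0"
    then obtain N where "\<And>n d. n \<ge> N \<Longrightarrow> cmod (pairing (\<lambda>z. F n z - G z) d) \<le> r / 2 * form_norm k d"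
      using near[of "r / 2"] by auto
    then have "rkhs_norm k (\<lambda>z. F n z - G z) \<le> r / 2" if "n \<ge> N" for n
      using that \<open>r > 0\<close> F GE by (intro rkhs_norm_le) auto
    then have "norm (rkhs_norm k (\<lambda>z. F n z - G z) - 0) < r" if "n \<ge> N" for n
      using that \<open>r > 0\<close> rkhs_norm_nonneg[of "\<lambda>z. F n z - G z"] F GE by fastforce
    then show "\<exists>N. \<forall>n\<ge>N. norm (rkhs_norm k (\<lambda>z. F n z - G z) - 0) < r" by blast
  qed
  with GE show thesis by (rule that)
qed

end

text \<open>Vectors of \<open>rkhs k\<close> are coded by \<open>J\<close>. Decoding everything outside the carrier as the zero
  function makes \<open>hdist\<close> symmetric on the whole type, as the locale \<open>Metric_space\<close> requires.\<close>

definition decode :: "(('y \<Rightarrow> complex) \<Rightarrow> 'v) \<Rightarrow> ('y \<Rightarrow> 'y \<Rightarrow> complex) \<Rightarrow> 'v \<Rightarrow> 'y \<Rightarrow> complex" where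
  "decode J k x = (if x \<in> J ` rkhs k then inv_into UNIV J x else (\<lambda>z. 0))"

definition rkhs_hilbert :: "(('y \<Rightarrow> complex) \<Rightarrow> 'v) \<Rightarrow> ('y \<Rightarrow> 'y \<Rightarrow> complex) \<Rightarrow> 'v hilbert" where
  "rkhs_hilbert J k = \<lparr>carrier = J ` rkhs k, monoid.mult = undefined, one = undefined,
     zero = J (\<lambda>z. 0), add = (\<lambda>x y. J (\<lambda>z. decode J k x z + decode J k y z)),
     smult = (\<lambda>a x. J (\<lambda>z. a * decode J k x z)),
     hinner = (\<lambda>x y. rkhs_inner k (decode J k x) (decode J k y))\<rparr>"

lemma rkhs_hilbert_sel [simp]:
  "carrier (rkhs_hilbert J k) = J ` rkhs k" "zero (rkhs_hilbert J k) = J (\<lambda>z. 0)"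
  "add (rkhs_hilbert J k) x y = J (\<lambda>z. decode J k x z + decode J k y z)"
  "smult (rkhs_hilbert J k) a x = J (\<lambda>z. a * decode J k x z)"
  "hinner (rkhs_hilbert J k) x y = rkhs_inner k (decode J k x) (decode J k y)"
  by (auto simp: rkhs_hilbert_def)

section \<open>The Hilbert space structure on coded vectors\<close>

context
  fixes J :: "('y \<Rightarrow> complex) \<Rightarrow> 'v" and k :: "'y \<Rightarrow> 'y \<Rightarrow> complex"
  assumes J: "inj J" and k: "pd_kernel k"
begin

lemmas rkhs_simps [simp] = rkhs_zero[OF k] rkhs_add[OF k] rkhs_scale[OF k] rkhs_uminus[OF k] rkhs_diff[OF k]

lemma decode_J [simp]: "F \<in> rkhs k \<Longrightarrow> decode J k (J F) = F"
  using J by (simp add: decode_def)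

lemma decode_in [simp]: "decode J k x \<in> rkhs k"
  using J by (auto simp: decode_def)

lemma J_decode: "x \<in> J ` rkhs k \<Longrightarrow> J (decode J k x) = x"
  using decode_J by auto

lemma J_eq [simp]: "J F = J G \<longleftrightarrow> F = G"
  using J by (auto dest: injD)

text \<open>\<open>a_inv\<close> is a definite description over the carrier, so it has to be
  computed anew on the carrier \<open>V\<close> of a subrepresentation.\<close>

lemma a_inv_sub:
  assumes "V \<subseteq> J ` rkhs k" "J (\<lambda>z. - decode J k y z) \<in> V"
  shows "a_inv (rkhs_hilbert J k\<lparr>carrier := V\<rparr>) y = J (\<lambda>z. - decode J k y z)"
  unfolding a_inv_def m_inv_def
proof (rule the_equality)
  fix w
  assume *: "w \<in> carrier (add_monoid (rkhs_hilbert J k\<lparr>carrier := V\<rparr>)) \<and>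
    y \<otimes>\<^bsub>add_monoid (rkhs_hilbert J k\<lparr>carrier := V\<rparr>)\<^esub> w = \<one>\<^bsub>add_monoid (rkhs_hilbert J k\<lparr>carrier := V\<rparr>)\<^esub> \<and>
    w \<otimes>\<^bsub>add_monoid (rkhs_hilbert J k\<lparr>carrier := V\<rparr>)\<^esub> y = \<one>\<^bsub>add_monoid (rkhs_hilbert J k\<lparr>carrier := V\<rparr>)\<^esub>"
  then have "(\<lambda>z. decode J k y z + decode J k w z) = (\<lambda>z. 0)" by simp
  then have "decode J k w = (\<lambda>z. - decode J k y z)"
    by (auto simp: fun_eq_iff eq_neg_iff_add_eq_0 add.commute)
  then show "w = J (\<lambda>z. - decode J k y z)"
    using J_decode[of w] * assms(1) by auto
qed (use assms in auto)

lemma a_minus_sub: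
  assumes "V \<subseteq> J ` rkhs k" "J (\<lambda>z. - decode J k y z) \<in> V"
  shows "a_minus (rkhs_hilbert J k\<lparr>carrier := V\<rparr>) x y = J (\<lambda>z. decode J k x z - decode J k y z)"
  unfolding a_minus_def a_inv_sub[OF assms] by simp

lemma a_inv_rkhs_hilbert: "a_inv (rkhs_hilbert J k) y = J (\<lambda>z. - decode J k y z)"
proof -
  have eq: "rkhs_hilbert J k\<lparr>carrier := J ` rkhs k\<rparr> = rkhs_hilbert J k" by (simp add: rkhs_hilbert_def)
  show ?thesis using a_inv_sub[of "J ` rkhs k" y, unfolded eq] by simp
qed

lemma a_minus_rkhs_hilbert: "a_minus (rkhs_hilbert J k) x y = J (\<lambda>z. decode J k x z - decode J k y z)"
  unfolding a_minus_def a_inv_rkhs_hilbert by simp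

lemma hnorm_rkhs_hilbert: "hnorm (rkhs_hilbert J k) x = rkhs_norm k (decode J k x)"
  by (simp add: hnorm_def rkhs_norm_def)

lemma hdist_rkhs_hilbert: "hdist (rkhs_hilbert J k) x y = rkhs_norm k (\<lambda>z. decode J k x z - decode J k y z)"
  by (simp add: hdist_def hnorm_rkhs_hilbert a_minus_rkhs_hilbert)

lemma Metric_space_rkhs_hilbert: "Metric_space (carrier (rkhs_hilbert J k)) (hdist (rkhs_hilbert J k))"
proof
  fix x y z :: 'v
  show "0 \<le> hdist (rkhs_hilbert J k) x y"
    by (simp add: hdist_rkhs_hilbert rkhs_norm_nonneg[OF k])
  show "hdist (rkhs_hilbert J k) x y = hdist (rkhs_hilbert J k) y x"
    using rkhs_norm_uminus[OF k, of "\<lambda>z. decode J k x z - decode J k y z"] by (simp add: hdist_rkhs_hilbert)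
  show "hdist (rkhs_hilbert J k) x z \<le> hdist (rkhs_hilbert J k) x y + hdist (rkhs_hilbert J k) y z"
    using rkhs_norm_triangle[OF k, of "\<lambda>w. decode J k x w - decode J k y w" "\<lambda>w. decode J k y w - decode J k z w"]
    by (simp add: hdist_rkhs_hilbert)
  assume xy: "x \<in> carrier (rkhs_hilbert J k)" "y \<in> carrier (rkhs_hilbert J k)"
  show "hdist (rkhs_hilbert J k) x y = 0 \<longleftrightarrow> x = y"
  proof
    assume "hdist (rkhs_hilbert J k) x y = 0"
    then have "(\<lambda>z. decode J k x z - decode J k y z) = (\<lambda>z. 0)"
      by (intro rkhs_norm_eq_0[OF k]) (auto simp: hdist_rkhs_hilbert)
    then have "decode J k x = decode J k y" by (simp add: fun_eq_iff)
    then show "x = y" using xy J_decode by (metis rkhs_hilbert_sel(1))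
  next
    assume "x = y"
    then show "hdist (rkhs_hilbert J k) x y = 0"
      using rkhs_norm_comb[OF k, of "[]"] by (simp add: hdist_rkhs_hilbert comb_def[abs_def] form_norm_def)
  qed
qed

lemma hilbert_space_rkhs_hilbert: "hilbert_space (rkhs_hilbert J k)"
proof -
  have ring: "cring complex_ring"
    by (intro cringI abelian_groupI comm_monoidI)
      (auto simp: complex_ring_def algebra_simps intro: exI[of _ "- x" for x :: complex])
  have grp: "abelian_group (rkhs_hilbert J k)"
  proof (rule abelian_groupI)
    fix x
    assume "x \<in> carrier (rkhs_hilbert J k)"
    then show "\<exists>y\<in>carrier (rkhs_hilbert J k). y \<oplus>\<^bsub>rkhs_hilbert J k\<^esub> x = \<zero>\<^bsub>rkhs_hilbert J k\<^esub>"
      by (intro bexI[of _ "J (\<lambda>z. - decode J k x z)"]) auto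
  qed (auto simp: algebra_simps)
  have "module complex_ring (rkhs_hilbert J k)"
    by (rule moduleI[OF ring grp]) (auto simp: complex_ring_def distrib_left distrib_right mult.assoc J_decode)
  moreover have "hilbert_space_axioms (rkhs_hilbert J k)"
  proof
    fix x y z a
    assume xy: "x \<in> carrier (rkhs_hilbert J k)" "y \<in> carrier (rkhs_hilbert J k)"
    show "hinner (rkhs_hilbert J k) (x \<oplus>\<^bsub>rkhs_hilbert J k\<^esub> y) z = hinner (rkhs_hilbert J k) x z + hinner (rkhs_hilbert J k) y z"
      by (simp add: rkhs_inner_add_left[OF k])
    show "hinner (rkhs_hilbert J k) (a \<odot>\<^bsub>rkhs_hilbert J k\<^esub> x) y = a * hinner (rkhs_hilbert J k) x y"
      by (simp add: rkhs_inner_scale_left[OF k])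
    show "hinner (rkhs_hilbert J k) y x = cnj (hinner (rkhs_hilbert J k) x y)"
      using rkhs_inner_commute[OF k decode_in[of x] decode_in[of y]] by (simp only: rkhs_hilbert_sel)
  next
    fix x
    assume x: "x \<in> carrier (rkhs_hilbert J k)"
    show "0 \<le> Re (hinner (rkhs_hilbert J k) x x)"
      by (simp add: rkhs_inner_self[OF k])
    assume "hinner (rkhs_hilbert J k) x x = 0"
    then have "decode J k x = (\<lambda>z. 0)"
      by (intro rkhs_norm_eq_0[OF k]) (simp_all add: rkhs_norm_def)
    then show "x = \<zero>\<^bsub>rkhs_hilbert J k\<^esub>"
      using J_decode[of x] x by simp
  next
    show "Metric_space.mcomplete (carrier (rkhs_hilbert J k)) (hdist (rkhs_hilbert J k))"
      unfolding Metric_space.mcomplete_def[OF Metric_space_rkhs_hilbert]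
    proof (intro allI impI)
      fix \<sigma>
      assume "Metric_space.MCauchy (carrier (rkhs_hilbert J k)) (hdist (rkhs_hilbert J k)) \<sigma>"
      then have \<sigma>: "\<And>n. \<sigma> n \<in> J ` rkhs k"
        "\<And>e. e > 0 \<Longrightarrow> \<exists>N. \<forall>n n'. N \<le> n \<longrightarrow> N \<le> n' \<longrightarrow> hdist (rkhs_hilbert J k) (\<sigma> n) (\<sigma> n') < e"
        unfolding Metric_space.MCauchy_def[OF Metric_space_rkhs_hilbert] by auto
      obtain G where G: "G \<in> rkhs k" "(\<lambda>n. rkhs_norm k (\<lambda>z. decode J k (\<sigma> n) z - G z)) \<longlonglongrightarrow> 0"
      proof (rule rkhs_complete[OF k, of "\<lambda>n. decode J k (\<sigma> n)"])
        show "\<exists>N. \<forall>m\<ge>N. \<forall>n\<ge>N. rkhs_norm k (\<lambda>z. decode J k (\<sigma> m) z - decode J k (\<sigma> n) z) < e" if "e > 0" for e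
          using \<sigma>(2)[OF that] by (auto simp: hdist_rkhs_hilbert)
      qed auto
      have "\<exists>N. \<forall>n\<ge>N. \<sigma> n \<in> J ` rkhs k \<and> hdist (rkhs_hilbert J k) (\<sigma> n) (J G) < e" if "e > 0" for e
        using LIMSEQ_D[OF G(2) that] \<sigma>(1) G(1) by (auto simp: hdist_rkhs_hilbert abs_less_iff)
      then show "\<exists>x. limitin (Metric_space.mtopology (carrier (rkhs_hilbert J k)) (hdist (rkhs_hilbert J k))) \<sigma> x sequentially"
        unfolding Metric_space.limit_metric_sequentially[OF Metric_space_rkhs_hilbert]
        using G(1) by (intro exI[of _ "J G"]) simp
    qed
  qed
  ultimately show ?thesis by (rule hilbert_space.intro)
qed

end

section \<open>The translation representation\<close>

lemma form_map: "form k (map (apsnd p) c) (map (apsnd p) d) = form (\<lambda>y z. k (p y) (p z)) c d"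
  by (simp add: form_def case_prod_unfold o_def)

lemma pd_kernel_pullback: "pd_kernel k \<Longrightarrow> pd_kernel (\<lambda>y z. k (p y) (p z))"
  unfolding pd_kernel_def by (simp flip: form_map)

lemma pd_kernel_sum: "(\<And>i. i \<in> A \<Longrightarrow> pd_kernel (k i)) \<Longrightarrow> pd_kernel (\<lambda>y z. \<Sum>i\<in>A. k i y z)"
proof (induction A rule: infinite_finite_induct)
  case (insert i A)
  then show ?case by (simp add: pd_kernel_add)
qed (use pd_kernel_cmult[OF order_refl pd_kernel_one] in auto)

text \<open>The kernel of the Hilbert sum of the GNS spaces of the functions \<open>\<Phi> i\<close>.\<close>

definition sum_kernel :: "('i \<Rightarrow> 'g::group_add \<Rightarrow> real) \<Rightarrow> 'i \<times> 'g \<Rightarrow> 'i \<times> 'g \<Rightarrow> complex" where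
  "sum_kernel \<Phi> y z = (if fst y = fst z then complex_of_real (\<Phi> (fst y) (- snd z + snd y)) else 0)"

text \<open>Only finitely many indices occur in a list, so on its points the kernel agrees with a
  finite sum of GNS kernels, each cut down to one index by twisting with an indicator.\<close>

lemma pd_kernel_sum_kernel:
  assumes "\<And>i. pd_fun (\<lambda>g. complex_of_real (\<Phi> i g))"
  shows "pd_kernel (sum_kernel \<Phi>)"
  unfolding pd_kernel_def
proof
  fix c :: "(complex \<times> 'a \<times> 'b) list"
  define I where "I = (fst \<circ> snd) ` set c"
  define k where "k i y z = of_bool (fst y = i) * cnj (of_bool (fst z = i)) * complex_of_real (\<Phi> i (- snd z + snd y))"
    for i and y z :: "'a \<times> 'b"
  have "pd_kernel (k i)" for i
  proof -
    have "pd_kernel (\<lambda>y z :: 'a \<times> 'b. complex_of_real (\<Phi> i (- snd z + snd y)))"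
      using pd_kernel_pullback[of "\<lambda>g h. complex_of_real (\<Phi> i (- h + g))" snd] assms
      by (simp add: pd_fun_def)
    then show ?thesis
      unfolding pd_kernel_def k_def form_twist by blast
  qed
  then have "pd_kernel (\<lambda>y z. \<Sum>i\<in>I. k i y z)" by (rule pd_kernel_sum)
  moreover have "form (sum_kernel \<Phi>) c c = form (\<lambda>y z. \<Sum>i\<in>I. k i y z) c c"
  proof (rule form_cong)
    fix y z
    assume "y \<in> snd ` set c" "z \<in> snd ` set c"
    then have "fst y \<in> I" "finite I" by (auto simp: I_def)
    have "(\<Sum>i\<in>I. k i y z) = (\<Sum>i\<in>I. if fst y = i then sum_kernel \<Phi> y z else 0)"
      by (intro sum.cong) (auto simp: k_def sum_kernel_def)
    then show "sum_kernel \<Phi> y z = (\<Sum>i\<in>I. k i y z)"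
      using \<open>fst y \<in> I\<close> \<open>finite I\<close> by simp
  qed
  ultimately show "form (sum_kernel \<Phi>) c c \<in> \<real>\<^sub>\<ge>\<^sub>0"
    by (simp add: pd_kernel_def)
qed

section \<open>Translation of points, combinations and functions\<close>

definition translate :: "'g::group_add \<Rightarrow> 'i \<times> 'g \<Rightarrow> 'i \<times> 'g" where
  "translate g = apsnd ((+) g)"

definition translate_list :: "'g::group_add \<Rightarrow> (complex \<times> 'i \<times> 'g) list \<Rightarrow> (complex \<times> 'i \<times> 'g) list" where
  "translate_list g = map (apsnd (translate g))"

definition shift :: "'g::group_add \<Rightarrow> ('i \<times> 'g \<Rightarrow> complex) \<Rightarrow> 'i \<times> 'g \<Rightarrow> complex" where
  "shift g F = F \<circ> translate (- g)"

lemma translate_simps [simp]: "translate g (i, h) = (i, g + h)" "translate g (translate h y) = translate (g + h) y" "translate 0 y = y"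
  by (cases y; simp add: translate_def add.assoc)+

lemma fst_translate [simp]: "fst (translate g y) = fst y" and snd_translate [simp]: "snd (translate g y) = g + snd y"
  by (simp_all add: translate_def)

lemma translate_list_translate_list [simp]: "translate_list g (translate_list h c) = translate_list (g + h) c" "translate_list 0 c = c"
proof -
  show "translate_list 0 c = c"
    unfolding translate_list_def by (rule map_idI) (metis apsnd_conv surj_pair translate_simps(3))
qed (simp add: translate_list_def o_def apsnd_compose)

lemma shift_shift: "shift g (shift h F) = shift (g + h) F" and shift_zero [simp]: "shift 0 F = F"
  by (auto simp: shift_def fun_eq_iff minus_add)

lemma pairing_shift: "pairing (shift g F) d = pairing F (translate_list (- g) d)"
  by (simp add: pairing_def shift_def translate_list_def case_prod_unfold o_def)

lemma sum_kernel_translate [simp]: "sum_kernel \<Phi> (translate g y) (translate g z) = sum_kernel \<Phi> y z"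
  by (simp add: sum_kernel_def minus_add add.assoc del: add_uminus_conv_diff)

lemma form_translate_list [simp]: "form (sum_kernel \<Phi>) (translate_list g c) (translate_list g d) = form (sum_kernel \<Phi>) c d"
  by (simp add: translate_list_def form_map)

lemma form_norm_translate_list [simp]: "form_norm (sum_kernel \<Phi>) (translate_list g c) = form_norm (sum_kernel \<Phi>) c"
  by (simp add: form_norm_def)

lemma approx_shift:
  assumes "approx (sum_kernel \<Phi>) F c e"
  shows "approx (sum_kernel \<Phi>) (shift g F) (translate_list g c) e"
  unfolding approx_def
proof
  fix d
  show "cmod (pairing (shift g F) d - form (sum_kernel \<Phi>) (translate_list g c) d) \<le> e * form_norm (sum_kernel \<Phi>) d"
    using assms[unfolded approx_def, rule_format, of "translate_list (- g) d"] form_translate_list[of \<Phi> "- g" "translate_list g c" d]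
    by (simp add: pairing_shift)
qed

lemma norm_form_le:
  assumes "\<And>y z. y \<in> snd ` set c \<Longrightarrow> z \<in> snd ` set d \<Longrightarrow> cmod (k y z) \<le> \<eta>"
  shows "cmod (form k c d) \<le> (\<Sum>(a, y)\<leftarrow>c. cmod a) * (\<Sum>(b, z)\<leftarrow>d. cmod b) * \<eta>"
  using assms
proof (induction c)
  case (Cons p c)
  obtain a y where p: "p = (a, y)" by force
  have "cmod (\<Sum>(b, z)\<leftarrow>d. cnj b * k y z) \<le> (\<Sum>(b, z)\<leftarrow>d. cmod b) * \<eta>"
    using Cons.prems
  proof (induction d)
    case (Cons q d)
    obtain b z where q: "q = (b, z)" by force
    have "cmod (cnj b * k y z) \<le> cmod b * \<eta>"
      using Cons.prems[of y z] by (simp add: p q norm_mult mult_left_mono)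
    moreover have "cmod (\<Sum>(b, z)\<leftarrow>d. cnj b * k y z) \<le> (\<Sum>(b, z)\<leftarrow>d. cmod b) * \<eta>"
      using Cons.prems by (intro Cons.IH) auto
    ultimately show ?case
      using norm_triangle_mono by (fastforce simp: q distrib_right)
  qed simp
  then have "cmod (a * (\<Sum>(b, z)\<leftarrow>d. cnj b * k y z)) \<le> cmod a * ((\<Sum>(b, z)\<leftarrow>d. cmod b) * \<eta>)"
    by (simp add: norm_mult mult_left_mono)
  moreover have "cmod (form k c d) \<le> (\<Sum>(a, y)\<leftarrow>c. cmod a) * (\<Sum>(b, z)\<leftarrow>d. cmod b) * \<eta>"
    using Cons.prems by (intro Cons.IH) auto
  ultimately show ?case
    using norm_triangle_mono by (fastforce simp: p form_Cons distrib_right mult.assoc)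
qed simp

lemma rkhs_inner_diff_left:
  assumes "pd_kernel k" "F \<in> rkhs k" "G \<in> rkhs k" "H \<in> rkhs k"
  shows "rkhs_inner k (\<lambda>z. F z - G z) H = rkhs_inner k F H - rkhs_inner k G H"
  using rkhs_inner_add_left[OF assms(1) rkhs_diff[OF assms(1-3)] assms(3,4)] by simp

lemma rkhs_inner_diff_right:
  assumes "pd_kernel k" "F \<in> rkhs k" "G \<in> rkhs k" "H \<in> rkhs k"
  shows "rkhs_inner k H (\<lambda>z. F z - G z) = rkhs_inner k H F - rkhs_inner k H G"
  unfolding rkhs_inner_commute[OF assms(1) rkhs_diff[OF assms(1-3)] assms(4)]
    rkhs_inner_commute[OF assms(1,2,4)] rkhs_inner_commute[OF assms(1,3,4)] rkhs_inner_diff_left[OF assms] by simp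

lemma rkhs_norm_diff_sq:
  assumes "pd_kernel k" "F \<in> rkhs k" "G \<in> rkhs k"
  shows "(rkhs_norm k (\<lambda>z. F z - G z))\<^sup>2 = (rkhs_norm k F)\<^sup>2 + (rkhs_norm k G)\<^sup>2 - 2 * Re (rkhs_inner k F G)"
proof -
  have "complex_of_real ((rkhs_norm k (\<lambda>z. F z - G z))\<^sup>2) =
      of_real ((rkhs_norm k F)\<^sup>2) + of_real ((rkhs_norm k G)\<^sup>2) - (rkhs_inner k F G + cnj (rkhs_inner k F G))"
    using assms rkhs_inner_commute[OF assms]
    by (simp add: rkhs_inner_self[OF assms(1), symmetric] rkhs_inner_diff_left rkhs_inner_diff_right del: of_real_power)
  also have "\<dots> = of_real ((rkhs_norm k F)\<^sup>2 + (rkhs_norm k G)\<^sup>2 - 2 * Re (rkhs_inner k F G))"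
    by (simp add: complex_eq_iff)
  finally show ?thesis using of_real_eq_iff by blast
qed

section \<open>Unitarity, continuity and displacement of translations\<close>

context
  fixes \<Phi> :: "'i \<Rightarrow> 'g::topological_group_add \<Rightarrow> real"
  assumes \<Phi>: "\<And>i. normalized_pd (\<lambda>g. complex_of_real (\<Phi> i g))"
begin

lemma pd_sum_kernel: "pd_kernel (sum_kernel \<Phi>)"
  using \<Phi> by (intro pd_kernel_sum_kernel) (auto simp: normalized_pd_def positive_definite_iff_pd_fun)

lemma shift_in [simp]: "F \<in> rkhs (sum_kernel \<Phi>) \<Longrightarrow> shift g F \<in> rkhs (sum_kernel \<Phi>)"
  by (rule rkhsI[OF pd_sum_kernel]) (meson approx_shift rkhsD[OF pd_sum_kernel])

lemma rkhs_inner_shift: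
  assumes "F \<in> rkhs (sum_kernel \<Phi>)" "G \<in> rkhs (sum_kernel \<Phi>)"
  shows "rkhs_inner (sum_kernel \<Phi>) (shift g F) (shift g G) = rkhs_inner (sum_kernel \<Phi>) F G"
proof (rule LIMSEQ_unique)
  note k = pd_sum_kernel
  show "(\<lambda>n. form (sum_kernel \<Phi>) (translate_list g (approximant (sum_kernel \<Phi>) F n)) (translate_list g (approximant (sum_kernel \<Phi>) G n)))
      \<longlonglongrightarrow> rkhs_inner (sum_kernel \<Phi>) (shift g F) (shift g G)"
    by (rule rkhs_inner_tendsto_form[OF k _ _ approx_shift[OF approx_approximant[OF k assms(1)]] _ inv_Suc_tendsto
          approx_shift[OF approx_approximant[OF k assms(2)]] _ inv_Suc_tendsto]) (use assms in auto)
  show "(\<lambda>n. form (sum_kernel \<Phi>) (translate_list g (approximant (sum_kernel \<Phi>) F n)) (translate_list g (approximant (sum_kernel \<Phi>) G n)))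
      \<longlonglongrightarrow> rkhs_inner (sum_kernel \<Phi>) F G"
    using rkhs_inner_form_approximant[OF k assms] by simp
qed

lemma rkhs_norm_shift [simp]: "F \<in> rkhs (sum_kernel \<Phi>) \<Longrightarrow> rkhs_norm (sum_kernel \<Phi>) (shift g F) = rkhs_norm (sum_kernel \<Phi>) F"
  by (simp add: rkhs_norm_def rkhs_inner_shift)

lemma form_translate_list_tendsto:
  "((\<lambda>g. form (sum_kernel \<Phi>) (translate_list g c) d) \<longlongrightarrow> form (sum_kernel \<Phi>) (translate_list g0 c) d) (nhds g0)"
proof -
  have K: "((\<lambda>g. sum_kernel \<Phi> (translate g y) z) \<longlongrightarrow> sum_kernel \<Phi> (translate g0 y) z) (nhds g0)" for y z :: "'i \<times> 'g"
  proof (cases "fst y = fst z")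
    case True
    have "continuous_on UNIV (\<lambda>g. complex_of_real (\<Phi> (fst y) g))"
      using \<Phi> by (simp add: normalized_pd_def)
    then have "continuous_on UNIV (\<lambda>g. complex_of_real (\<Phi> (fst y) (- snd z + (g + snd y))))"
      by (rule continuous_on_compose2) (auto intro!: continuous_intros)
    then have "continuous_on UNIV (\<lambda>g. sum_kernel \<Phi> (translate g y) z)"
      using True by (simp add: sum_kernel_def)
    then show ?thesis
      unfolding continuous_on_def by (intro tendsto_at_iff_tendsto_nhds[THEN iffD1]) blast
  qed (simp add: sum_kernel_def)
  have *: "((\<lambda>g. \<Sum>(b, z)\<leftarrow>d. a * cnj b * sum_kernel \<Phi> (translate g y) z) \<longlongrightarrow>
      (\<Sum>(b, z)\<leftarrow>d. a * cnj b * sum_kernel \<Phi> (translate g0 y) z)) (nhds g0)" for a y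
    by (induction d) (auto intro!: tendsto_intros K)
  have "((\<lambda>g. \<Sum>(a, y)\<leftarrow>c. \<Sum>(b, z)\<leftarrow>d. a * cnj b * sum_kernel \<Phi> (translate g y) z) \<longlongrightarrow>
      (\<Sum>(a, y)\<leftarrow>c. \<Sum>(b, z)\<leftarrow>d. a * cnj b * sum_kernel \<Phi> (translate g0 y) z)) (nhds g0)"
    by (induction c) (auto intro!: tendsto_add * simp del: translate_simps(1))
  moreover have "form (sum_kernel \<Phi>) (translate_list g c) d = (\<Sum>(a, y)\<leftarrow>c. \<Sum>(b, z)\<leftarrow>d. a * cnj b * sum_kernel \<Phi> (translate g y) z)" for g
    by (simp add: form_def translate_list_def case_prod_unfold o_def)
  ultimately show ?thesis by simp
qed

text \<open>For a combination, unitarity reduces the displacement to one continuous matrix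
  coefficient. A general vector is approximated with an error that translation preserves, hence
  uniformly in \<open>g\<close>.\<close>

lemma shift_continuous:
  assumes F: "F \<in> rkhs (sum_kernel \<Phi>)" and r: "r > 0"
  shows "\<forall>\<^sub>F g in nhds g0. rkhs_norm (sum_kernel \<Phi>) (\<lambda>z. shift g F z - shift g0 F z) < r"
proof -
  let ?k = "sum_kernel \<Phi>"
  note k = pd_sum_kernel
  obtain c where c: "approx ?k F c (r / 4)" using rkhsD[OF k F, of "r / 4"] r by auto
  define D where "D g = translate_list g c @ scale_list (-1) (translate_list g0 c)" for g
  have D: "(form_norm ?k (D g))\<^sup>2 = 2 * (form_norm ?k c)\<^sup>2 - 2 * Re (form ?k (translate_list g c) (translate_list g0 c))" for g
  proof -
    have "complex_of_real ((form_norm ?k (D g))\<^sup>2) = 2 * of_real ((form_norm ?k c)\<^sup>2)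
        - (form ?k (translate_list g c) (translate_list g0 c) + cnj (form ?k (translate_list g c) (translate_list g0 c)))"
      unfolding form_norm_sq[OF k, symmetric] pd_kernel_form_commute[OF k, of "translate_list g0 c" "translate_list g c", symmetric]
      by (simp add: D_def)
    also have "\<dots> = of_real (2 * (form_norm ?k c)\<^sup>2 - 2 * Re (form ?k (translate_list g c) (translate_list g0 c)))"
      by (simp add: complex_eq_iff)
    finally show ?thesis using of_real_eq_iff by blast
  qed
  have "((\<lambda>g. 2 * (form_norm ?k c)\<^sup>2 - 2 * Re (form ?k (translate_list g c) (translate_list g0 c))) \<longlongrightarrow>
      2 * (form_norm ?k c)\<^sup>2 - 2 * Re (form ?k (translate_list g0 c) (translate_list g0 c))) (nhds g0)"
    by (intro tendsto_intros form_translate_list_tendsto)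
  moreover have "2 * (form_norm ?k c)\<^sup>2 - 2 * Re (form ?k (translate_list g0 c) (translate_list g0 c)) = 0"
    using form_norm_sq[OF k, of c] by simp
  ultimately have "((\<lambda>g. (form_norm ?k (D g))\<^sup>2) \<longlongrightarrow> 0) (nhds g0)" by (simp add: D)
  then have "\<forall>\<^sub>F g in nhds g0. (form_norm ?k (D g))\<^sup>2 < (r / 4)\<^sup>2"
    by (rule order_tendstoD(2)) (use r in simp)
  then show ?thesis
  proof eventually_elim
    case (elim g)
    then have Dr: "form_norm ?k (D g) < r / 4" using r by (intro power2_less_imp_less[of _ "r / 4"]) auto
    have "rkhs_norm ?k (\<lambda>z. shift g F z - shift g0 F z) \<le> r / 4 + r / 4 + r / 4"
    proof (rule rkhs_norm_le[OF k])
      fix d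
      have "pairing (\<lambda>z. shift g F z - shift g0 F z) d =
          (pairing (shift g F) d - form ?k (translate_list g c) d) - (pairing (shift g0 F) d - form ?k (translate_list g0 c) d) + form ?k (D g) d"
        by (simp add: D_def)
      also have "cmod \<dots> \<le> cmod (pairing (shift g F) d - form ?k (translate_list g c) d)
          + cmod (pairing (shift g0 F) d - form ?k (translate_list g0 c) d) + cmod (form ?k (D g) d)"
        by (rule order_trans[OF norm_triangle_ineq add_right_mono[OF norm_triangle_ineq4]])
      also have "\<dots> \<le> r / 4 * form_norm ?k d + r / 4 * form_norm ?k d + r / 4 * form_norm ?k d"
      proof (intro add_mono approxD[OF k] approx_shift c)
        have "cmod (form ?k (D g) d) \<le> form_norm ?k (D g) * form_norm ?k d" by (rule form_Cauchy_Schwarz[OF k])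
        also have "\<dots> \<le> r / 4 * form_norm ?k d" using Dr form_norm_nonneg[OF k] by (intro mult_right_mono) auto
        finally show "cmod (form ?k (D g) d) \<le> r / 4 * form_norm ?k d" .
      qed
      finally show "cmod (pairing (\<lambda>z. shift g F z - shift g0 F z) d) \<le> (r / 4 + r / 4 + r / 4) * form_norm ?k d"
        by (simp add: distrib_right)
    qed (use F r in \<open>auto intro: rkhs_diff[OF k]\<close>)
    then show ?case using r by simp
  qed
qed

text \<open>With \<open>r\<close> the norm of \<open>F\<close>, the squared displacement is
  \<open>2 * r\<^sup>2\<close> minus twice the real part of the coefficient of \<open>F\<close> at
  \<open>x\<close>, so a coefficient below \<open>r\<^sup>2 / 2\<close> suffices. Up to the
  approximation error it involves only finitely many values of the \<open>\<Phi> i\<close>.\<close>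

lemma moved_vector:
  assumes B: "\<And>i g M. g \<notin> B i M \<Longrightarrow> \<Phi> i g \<le> exp (- M)" "\<And>i g. 0 \<le> \<Phi> i g"
    and U: "\<And>T. finite T \<Longrightarrow> \<not> U \<subseteq> (\<Union>(c, (i, h), M)\<in>T. (+) c ` {x. - h + x + h \<in> B i M})"
    and F: "F \<in> rkhs (sum_kernel \<Phi>)" "F \<noteq> (\<lambda>z. 0)"
  obtains x where "x \<in> U" "rkhs_norm (sum_kernel \<Phi>) F < rkhs_norm (sum_kernel \<Phi>) (\<lambda>z. shift x F z - F z)"
proof -
  let ?k = "sum_kernel \<Phi>"
  note k = pd_sum_kernel
  define r where "r = rkhs_norm ?k F"
  have r: "r > 0" using rkhs_norm_eq_0[OF k F(1)] F(2) rkhs_norm_nonneg[OF k F(1)] by (force simp: r_def)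
  obtain c where c: "approx ?k F c (r / 16)" using rkhsD[OF k F(1), of "r / 16"] r by auto
  define A where "A = (\<Sum>(a, y)\<leftarrow>c. cmod a)"
  \<comment> \<open>Chosen so that values below \<open>\<eta>\<close> bound the double sum by
    \<open>r\<^sup>2 / 8\<close>; the summand \<open>1\<close> keeps the denominator positive when
    all coefficients vanish.\<close>
  define \<eta> where "\<eta> = r\<^sup>2 / (8 * (A * A + 1))"
  have A1: "A * A + 1 > 0" using zero_le_square[of A] by linarith
  then have \<eta>: "\<eta> > 0" using r by (simp add: \<eta>_def)
  \<comment> \<open>The kernel between the translate of \<open>(i, h)\<close> by \<open>x\<close>
    and \<open>(i', h')\<close> is zero or \<open>\<Phi> i (- h' + x + h)\<close>, whose argument is
    the conjugate by \<open>h\<close> of \<open>- (h' - h) + x\<close>. The radius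
    \<open>- ln \<eta>\<close> turns the exponential bound into \<open>\<eta>\<close>.\<close>
  define T where "T = (\<lambda>((i, h), (i', h')). (h' - h, (i, h), - ln \<eta>)) ` (snd ` set c \<times> snd ` set c)"
  have "finite T" by (simp add: T_def)
  then obtain x where x: "x \<in> U" "x \<notin> (\<Union>(c, (i, h), M)\<in>T. (+) c ` {x. - h + x + h \<in> B i M})"
    using U by blast
  have small: "cmod (?k y z) \<le> \<eta>" if yz: "y \<in> snd ` set (translate_list x c)" "z \<in> snd ` set c" for y z
  proof -
    obtain i h where y: "y = (i, x + h)" "(i, h) \<in> snd ` set c"
      using yz(1) by (force simp: translate_list_def)
    obtain i' h' where z: "z = (i', h')" by force
    have "(h' - h, (i, h), - ln \<eta>) \<in> T"
      using y yz(2) z by (force simp: T_def)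
    then have "x \<notin> (+) (h' - h) ` {x. - h + x + h \<in> B i (- ln \<eta>)}"
      using x(2) by fast
    moreover have "x = (h' - h) + (- (h' - h) + x)" by (rule add_minus_cancel[symmetric])
    ultimately have "- h + (- (h' - h) + x) + h \<notin> B i (- ln \<eta>)" by blast
    moreover have "- h + (- (h' - h) + x) + h = - h' + (x + h)"
      by (simp add: minus_add add.assoc flip: add_uminus_conv_diff)
    ultimately have "\<Phi> i (- h' + (x + h)) \<le> \<eta>"
      using B(1)[of "- h' + (x + h)" i "- ln \<eta>"] \<eta> by simp
    then show ?thesis
      using B(2)[of i "- h' + (x + h)"] \<eta> by (auto simp: sum_kernel_def y z)
  qed
  have "cmod (form ?k (translate_list x c) c) \<le> (\<Sum>(a, y)\<leftarrow>translate_list x c. cmod a) * A * \<eta>"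
    unfolding A_def by (rule norm_form_le[OF small])
  also have "(\<Sum>(a, y)\<leftarrow>translate_list x c. cmod a) = A"
    by (simp add: A_def translate_list_def case_prod_unfold o_def)
  also have "A * A * \<eta> \<le> (A * A + 1) * \<eta>" using \<eta> by simp
  also have "(A * A + 1) * \<eta> = r\<^sup>2 / 8" 
  proof -
    have "s * (r\<^sup>2 / (8 * s)) = r\<^sup>2 / 8" if "s > 0" for s using that by simp
    from this[OF A1] show ?thesis unfolding \<eta>_def .
  qed
  finally have f: "cmod (form ?k (translate_list x c) c) \<le> r\<^sup>2 / 8" .
  define G where "G = comb ?k c"
  have G: "G \<in> rkhs ?k" and FG: "rkhs_norm ?k (\<lambda>z. F z - G z) \<le> r / 16"
    using rkhs_norm_approx[OF k F(1) c] r comb_in_rkhs[OF k] by (auto simp: G_def)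
  have "rkhs_inner ?k (shift x F) F = rkhs_inner ?k (shift x F) (\<lambda>z. F z - G z) + rkhs_inner ?k (shift x F) G"
    using F(1) G by (simp add: rkhs_inner_diff_right[OF k])
  moreover have "rkhs_inner ?k (shift x F) G = (pairing (shift x F) c - form ?k (translate_list x c) c) + form ?k (translate_list x c) c"
    using F(1) by (simp add: G_def rkhs_inner_comb[OF k])
  moreover have "cmod (rkhs_inner ?k (shift x F) (\<lambda>z. F z - G z)) \<le> r * (r / 16)"
  proof -
    have "cmod (rkhs_inner ?k (shift x F) (\<lambda>z. F z - G z)) \<le> rkhs_norm ?k (shift x F) * rkhs_norm ?k (\<lambda>z. F z - G z)"
      using F(1) G by (intro rkhs_inner_Cauchy_Schwarz[OF k] shift_in rkhs_diff[OF k])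
    also have "\<dots> \<le> r * (r / 16)"
      using F(1) FG r by (simp add: r_def[symmetric])
    finally show ?thesis .
  qed
  moreover have "cmod (pairing (shift x F) c - form ?k (translate_list x c) c) \<le> r / 16 * (2 * r)"
  proof -
    have "rkhs_norm ?k G \<le> rkhs_norm ?k F + rkhs_norm ?k (\<lambda>z. - (F z - G z))"
      using rkhs_norm_triangle[OF k F(1), of "\<lambda>z. - (F z - G z)"] F(1) G k by simp
    also have "\<dots> \<le> 2 * r"
      using FG rkhs_norm_uminus[OF k rkhs_diff[OF k F(1) G]] r by (simp add: r_def[symmetric])
    finally have "form_norm ?k c \<le> 2 * r" by (simp add: G_def rkhs_norm_comb[OF k])
    then show ?thesis
      using approx_shift[OF c, unfolded approx_def, rule_format, of x c] r
      by (meson order_trans mult_left_mono divide_nonneg_nonneg less_imp_le zero_le_numeral)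
  qed
  \<comment> \<open>The three errors add up to \<open>5 * r\<^sup>2 / 16\<close>, below the
    threshold \<open>r\<^sup>2 / 2\<close>.\<close>
  ultimately have "cmod (rkhs_inner ?k (shift x F) F) \<le> r * (r / 16) + (r / 16 * (2 * r) + r\<^sup>2 / 8)"
    using f by (metis norm_triangle_mono)
  also have "\<dots> = 5 * r\<^sup>2 / 16" by (simp add: power2_eq_square)
  finally have "Re (rkhs_inner ?k (shift x F) F) \<le> 5 * r\<^sup>2 / 16"
    using complex_Re_le_cmod order_trans by blast
  moreover have "r\<^sup>2 > 0" using r by simp
  moreover have "(rkhs_norm ?k (\<lambda>z. shift x F z - F z))\<^sup>2 = r\<^sup>2 + r\<^sup>2 - 2 * Re (rkhs_inner ?k (shift x F) F)"
    using F(1) by (simp add: rkhs_norm_diff_sq[OF k] r_def[symmetric])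
  ultimately have "r\<^sup>2 < (rkhs_norm ?k (\<lambda>z. shift x F z - F z))\<^sup>2" by linarith
  then have "r < rkhs_norm ?k (\<lambda>z. shift x F z - F z)"
    by (rule power2_less_imp_less) (use F(1) in \<open>intro rkhs_norm_nonneg[OF k] rkhs_diff[OF k] shift_in\<close>)
  with x(1) show thesis using that unfolding r_def by blast
qed

end

section \<open>Relative Property (T) and resolutions\<close>

lemma locally_compact_nhd_0:
  assumes "locally_compact_space (euclidean :: 'a::{topological_space, zero} topology)"
  obtains U :: "'a::{topological_space, zero} set" where "compact U" "0 \<in> interior U"
proof -
  obtain V K :: "'a::{topological_space, zero} set" where "open V" "compact K" "0 \<in> V" "V \<subseteq> K"
    using assms[unfolded locally_compact_space_def, rule_format, of 0]
    unfolding topspace_euclidean compactin_euclidean_iff open_openin[symmetric] by blast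
  then show thesis using that interior_maximal by blast
qed

text \<open>The definition is applied to the filter generated by the sets of normalized functions
  that are close to \<open>1\<close> on a compact set; an eventual property of it already holds on
  one generating set.\<close>

lemma relative_property_TD:
  assumes X: "relative_property_T (X :: 'g::topological_group_add set)" and e: "e > 0"
  obtains K \<eta> where "compact K" "\<eta> > 0"
    "\<And>\<phi> x. normalized_pd \<phi> \<Longrightarrow> (\<And>y. y \<in> K \<Longrightarrow> cmod (\<phi> y - 1) < \<eta>) \<Longrightarrow> x \<in> X \<Longrightarrow> cmod (\<phi> x - 1) < e"
proof -
  define I where "I = {(K :: 'g set, \<eta> :: real). compact K \<and> \<eta> > 0}"
  define P where "P = (\<lambda>(K :: 'g set, \<eta>). {\<phi>. normalized_pd \<phi> \<and> (\<forall>y\<in>K. dist (\<phi> y) 1 < \<eta>)})"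
  define F where "F = (INF i\<in>I. principal (P i))"
  have eventually_F: "eventually Q F \<longleftrightarrow> (\<exists>i\<in>I. eventually Q (principal (P i)))" for Q
    unfolding F_def
  proof (rule eventually_INF_base)
    have "({}, 1) \<in> I" by (simp add: I_def)
    then show "I \<noteq> {}" by blast
    fix a b
    assume ab: "a \<in> I" "b \<in> I"
    show "\<exists>x\<in>I. principal (P x) \<le> inf (principal (P a)) (principal (P b))"
    proof
      show "(fst a \<union> fst b, min (snd a) (snd b)) \<in> I"
        using ab by (auto simp: I_def intro: compact_Un)
    qed (auto simp: P_def)
  qed
  have "eventually normalized_pd F"
    unfolding eventually_F by (rule bexI[of _ "({}, 1)"]) (auto simp: eventually_principal P_def I_def)
  moreover have "uniform_limit K (\<lambda>\<phi>. \<phi>) (\<lambda>_. 1) F" if "compact K" for K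
    unfolding uniform_limit_iff eventually_F
  proof (intro allI impI)
    fix \<eta> :: real
    assume "\<eta> > 0"
    then show "\<exists>i\<in>I. \<forall>\<^sub>F \<phi> in principal (P i). \<forall>x\<in>K. dist (\<phi> x) 1 < \<eta>"
      using that by (intro bexI[of _ "(K, \<eta>)"]) (auto simp: eventually_principal P_def I_def)
  qed
  ultimately have "uniform_limit X (\<lambda>\<phi>. \<phi>) (\<lambda>_. 1) F"
    using X unfolding relative_property_T_def by blast
  then have "\<forall>\<^sub>F \<phi> in F. \<forall>x\<in>X. dist (\<phi> x) 1 < e"
    using e unfolding uniform_limit_iff by blast
  then obtain K \<eta> where "(K, \<eta>) \<in> I" "\<forall>\<phi>\<in>P (K, \<eta>). \<forall>x\<in>X. dist (\<phi> x) 1 < e"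
    unfolding eventually_F eventually_principal by auto
  then show thesis
    by (intro that[of K \<eta>]) (auto simp: I_def P_def dist_norm)
qed

section \<open>Pullback of positive definite functions along morphisms\<close>

lemma morphismD:
  assumes "morphism f"
  shows "continuous_on UNIV f" "f (g + h) = f g + f h" "f 0 = 0" "f (- g) = - f g"
proof -
  show "continuous_on UNIV f" and add: "f (g + h) = f g + f h" for g h
    using assms by (auto simp: morphism_def)
  show 0: "f 0 = 0" using add[of 0 0] add_left_cancel[of "f 0" "f 0" 0] by simp
  show "f (- g) = - f g"
    using add[of "- g" g] 0 by (simp add: eq_neg_iff_add_eq_0)
qed

lemma normalized_pd_morphism:
  assumes "morphism f" "normalized_pd \<phi>"
  shows "normalized_pd (\<lambda>g. \<phi> (f g))"
  unfolding normalized_pd_def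
proof (intro conjI)
  show "continuous_on UNIV (\<lambda>g. \<phi> (f g))"
    using assms morphismD(1)[OF assms(1)]
    by (intro continuous_on_compose2[of UNIV \<phi> UNIV f]) (auto simp: normalized_pd_def)
  show "positive_definite (\<lambda>g. \<phi> (f g))"
    unfolding positive_definite_def
  proof (intro allI)
    fix n :: nat and g :: "nat \<Rightarrow> 'a" and c :: "nat \<Rightarrow> complex"
    show "(\<Sum>i<n. \<Sum>j<n. c i * cnj (c j) * \<phi> (f (- g j + g i))) \<in> \<real>\<^sub>\<ge>\<^sub>0"
      using assms(2)[unfolded normalized_pd_def positive_definite_def, THEN conjunct2, THEN conjunct1, rule_format,
          where n = n and g = "\<lambda>i. f (g i)" and c = c]
      by (simp add: morphismD[OF assms(1)])
  qed
qed (use assms in \<open>auto simp: morphismD normalized_pd_def\<close>)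

text \<open>The quantitative form with gap \<open>1 / 2\<close> is applied to a pulled back
  function; \<open>f x\<close> then lies in the compact set outside which the function on the target
  is below \<open>1 / 2\<close>.\<close>

lemma compact_closure_image_if_relative_property_T:
  fixes f :: "'g::topological_group_add \<Rightarrow> 'q::{topological_group_add, t2_space}"
  assumes f: "morphism f" and Q: "haagerup TYPE('q)" and X: "relative_property_T X"
  shows "compact (closure (f ` X))"
proof -
  obtain K \<eta> where K: "compact K" "\<eta> > 0"
    "\<And>\<phi> x. normalized_pd \<phi> \<Longrightarrow> (\<And>y. y \<in> K \<Longrightarrow> cmod (\<phi> y - 1) < \<eta>) \<Longrightarrow> x \<in> X \<Longrightarrow> cmod (\<phi> x - 1) < 1 / 2"
    using relative_property_TD[OF X, of "1 / 2"] by auto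
  have "compact (f ` K)"
    using K(1) continuous_on_subset[OF morphismD(1)[OF f]] by (intro compact_continuous_image) auto
  then obtain \<phi> :: "'q \<Rightarrow> real" where \<phi>: "normalized_pd (\<lambda>g. complex_of_real (\<phi> g))"
      "vanishes_at_infinity \<phi>" "\<And>g. g \<in> f ` K \<Longrightarrow> \<phi> g > 1 - \<eta>"
    using Q[unfolded haagerup_def, rule_format, OF \<open>compact (f ` K)\<close> K(2)] by blast
  have le: "\<phi> g \<le> 1" for g
    using pd_fun_norm_le[of "\<lambda>g. complex_of_real (\<phi> g)" g] \<phi>(1)
    by (simp add: normalized_pd_def positive_definite_iff_pd_fun)
  obtain C where C: "compact C" "\<And>g. g \<notin> C \<Longrightarrow> \<bar>\<phi> g\<bar> < 1 / 2"
    using \<phi>(2)[unfolded vanishes_at_infinity_def, rule_format, of "1 / 2"] by auto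
  have dist_1: "cmod (complex_of_real (\<phi> q) - 1) = \<bar>\<phi> q - 1\<bar>" for q
    by (metis norm_of_real of_real_1 of_real_diff)
  have "f x \<in> C" if "x \<in> X" for x
  proof (rule ccontr)
    have "cmod (complex_of_real (\<phi> (f y)) - 1) < \<eta>" if "y \<in> K" for y
      using \<phi>(3)[of "f y"] le[of "f y"] that unfolding dist_1 by auto
    then have "cmod (complex_of_real (\<phi> (f x)) - 1) < 1 / 2"
      using K(3)[OF normalized_pd_morphism[OF f \<phi>(1)] _ that] by blast
    then have "\<bar>\<phi> (f x) - 1\<bar> < 1 / 2" unfolding dist_1 .
    moreover assume "f x \<notin> C"
    ultimately show False using C(2)[of "f x"] by linarith
  qed
  then have "closure (f ` X) \<subseteq> C"
    using compact_imp_closed[OF C(1)] by (intro closure_minimal) auto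
  then show ?thesis
    using C(1) compact_Int_closed[OF C(1) closed_closure, of "f ` X"] by (simp add: Int_absorb1)
qed

text \<open>Properness is what makes the pulled back functions vanish at infinity.\<close>

lemma haagerup_if_proper:
  fixes f :: "'g::topological_group_add \<Rightarrow> 'q::topological_group_add"
  assumes f: "proper_morphism f" and Q: "haagerup TYPE('q)"
  shows "haagerup TYPE('g)"
  unfolding haagerup_def
proof (intro allI impI)
  fix K :: "'g set" and \<epsilon> :: real
  assume K: "compact K" "\<epsilon> > 0"
  have m: "morphism f" using f by (simp add: proper_morphism_def)
  have "compact (f ` K)"
    using K(1) continuous_on_subset[OF morphismD(1)[OF m]] by (intro compact_continuous_image) auto
  then obtain \<phi> :: "'q \<Rightarrow> real" where \<phi>: "normalized_pd (\<lambda>g. complex_of_real (\<phi> g))"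
      "vanishes_at_infinity \<phi>" "\<And>g. g \<in> f ` K \<Longrightarrow> \<phi> g > 1 - \<epsilon>"
    using Q[unfolded haagerup_def, rule_format, OF \<open>compact (f ` K)\<close> K(2)] by blast
  have "vanishes_at_infinity (\<lambda>g. \<phi> (f g))"
    unfolding vanishes_at_infinity_def
  proof (intro allI impI)
    fix e :: real
    assume "e > 0"
    then obtain C where "compact C" "\<forall>g. g \<notin> C \<longrightarrow> \<bar>\<phi> g\<bar> < e"
      using \<phi>(2) unfolding vanishes_at_infinity_def by meson
    then show "\<exists>C. compact C \<and> (\<forall>g. g \<notin> C \<longrightarrow> \<bar>\<phi> (f g)\<bar> < e)"
      using f by (intro exI[of _ "f -` C"]) (auto simp: proper_morphism_def)
  qed
  then show "\<exists>\<phi>. normalized_pd (\<lambda>g. complex_of_real (\<phi> g)) \<and> vanishes_at_infinity \<phi> \<and> (\<forall>g\<in>K. \<phi> g > 1 - \<epsilon>)"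
    using normalized_pd_morphism[OF m \<phi>(1)] \<phi>(3) by (intro exI[of _ "\<lambda>g. \<phi> (f g)"]) auto
qed

lemma nhd_0_add_diff:
  assumes "open (W :: 'q::topological_group_add set)" "0 \<in> W"
  obtains W' where "open W'" "0 \<in> W'" "\<And>a b. a \<in> W' \<Longrightarrow> b \<in> W' \<Longrightarrow> a + b \<in> W \<and> - a + b \<in> W"
proof -
  let ?S = "(\<lambda>p. fst p + snd p) -` W \<inter> (\<lambda>p. - fst p + snd p) -` W"
  have "open ?S"
    using assms(1) by (intro open_Int open_vimage continuous_intros)
  moreover have "(0, 0) \<in> ?S" using assms(2) by simp
  ultimately obtain A B where "open A" "open B" "(0, 0) \<in> A \<times> B" "A \<times> B \<subseteq> ?S"
    by (rule open_prod_elim)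
  then show thesis by (intro that[of "A \<inter> B"]) (auto simp: subset_iff)
qed

text \<open>Replaces the unboundedness of \<open>X\<close> by that of the inverse images of the identity
  neighbourhoods, which are stable under conjugation.\<close>

lemma unbounded_near_kernel:
  fixes f :: "'g::topological_group_add \<Rightarrow> 'q::topological_group_add"
  assumes f: "morphism f" and X: "compact (closure (f ` X))" and B: "length_balls B"
    and unb: "\<And>M. \<not> X \<inter> \<Union>(range B) \<subseteq> B M" and W: "open W" "0 \<in> W"
  shows "\<not> f -` W \<inter> \<Union>(range (\<lambda>M. {x. - h + x + h \<in> B M})) \<subseteq> {x. - h + x + h \<in> B M}"
proof
  assume *: "f -` W \<inter> \<Union>(range (\<lambda>M. {x. - h + x + h \<in> B M})) \<subseteq> {x. - h + x + h \<in> B M}"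
  note f = morphismD[OF f]
  \<comment> \<open>Conjugation by \<open>f h\<close> brings the conjugated balls back to the
    original ones: \<open>f y \<in> W1\<close> says that \<open>h + y - h\<close> is mapped into
    \<open>W\<close>.\<close>
  define W1 where "W1 = (\<lambda>q. f h + q - f h) -` W"
  have "open W1" unfolding W1_def by (intro open_vimage W continuous_intros)
  moreover have "0 \<in> W1" using W by (simp add: W1_def)
  ultimately obtain W2 where W2: "open W2" "0 \<in> W2" "\<And>a b. a \<in> W2 \<Longrightarrow> b \<in> W2 \<Longrightarrow> - a + b \<in> W1"
    using nhd_0_add_diff by metis
  have W1B: "y \<in> B M" if "f y \<in> W1" "y \<in> \<Union>(range B)" for y
  proof -
    have y: "- h + (h + y - h) + h = y" by (simp add: add.assoc flip: add_uminus_conv_diff)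
    have "f (h + y - h) \<in> W"
      using that(1) by (simp add: W1_def f flip: add_uminus_conv_diff)
    then show ?thesis using * that(2) y by fastforce
  qed
  define S where "S = X \<inter> \<Union>(range B)"
  \<comment> \<open>Two points of \<open>S\<close> with images in the same translate of
    \<open>W2\<close> differ by an element of finite length with image in \<open>W1\<close>, so all
    of them are within bounded length of one chosen point \<open>p\<close>.\<close>
  have bounded: "\<exists>L. {x \<in> S. \<exists>q\<in>D. - q + f x \<in> W2} \<subseteq> B L" if "finite D" for D
    using that
  proof (induction D)
    case (insert q D)
    then obtain L where L: "{x \<in> S. \<exists>q\<in>D. - q + f x \<in> W2} \<subseteq> B L" by blast
    have "\<exists>L'. {x \<in> S. - q + f x \<in> W2} \<subseteq> B L'"
    proof (cases "{x \<in> S. - q + f x \<in> W2} = {}")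
      case False
      then obtain p M' where p: "p \<in> S" "- q + f p \<in> W2" "p \<in> B M'" by (auto simp: S_def)
      have "x \<in> B (4 * M' + 2 * M)" if x: "x \<in> S" "- q + f x \<in> W2" for x
      proof -
        have "- (- q + f p) + (- q + f x) = f (- p + x)"
          by (simp add: f minus_add add.assoc del: add_uminus_conv_diff)
        then have "f (- p + x) \<in> W1" using W2(3)[OF p(2) x(2)] by simp
        moreover have "- p + x \<in> \<Union>(range B)"
          using x(1) length_ballsD(3)[OF B p(3)] by (auto simp: S_def)
        ultimately have "- p + x \<in> B M" by (rule W1B)
        from length_balls_add[OF B p(3) this] show ?thesis by (simp add: add_minus_cancel)
      qed
      then show ?thesis by blast
    qed auto
    then obtain L' where L': "{x \<in> S. - q + f x \<in> W2} \<subseteq> B L'" by blast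
    have "{x \<in> S. \<exists>q\<in>insert q D. - q + f x \<in> W2} \<subseteq> B (max L L')"
      using L L' length_ballsD(2)[OF B max.cobounded1] length_ballsD(2)[OF B max.cobounded2] by blast
    then show ?case by blast
  qed auto
  define V where "V q = (\<lambda>p. - q + p) -` W2" for q
  have "\<forall>q\<in>closure (f ` X). open (V q)"
    unfolding V_def by (intro ballI open_vimage W2 continuous_intros)
  moreover have "closure (f ` X) \<subseteq> (\<Union>q\<in>closure (f ` X). V q)"
    using W2(2) by (auto simp: V_def)
  ultimately obtain D where D: "D \<subseteq> closure (f ` X)" "finite D" "closure (f ` X) \<subseteq> (\<Union>q\<in>D. V q)"
    using compactE_image[OF X, of "closure (f ` X)" V] by metis
  obtain L where "{x \<in> S. \<exists>q\<in>D. - q + f x \<in> W2} \<subseteq> B L" using bounded[OF D(2)] by blast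
  moreover have "S \<subseteq> {x \<in> S. \<exists>q\<in>D. - q + f x \<in> W2}"
    using D(3) closure_subset[of "f ` X"] by (auto simp: S_def V_def)
  ultimately show False using unb[of L] by (auto simp: S_def)
qed

section \<open>The translation representation and the resolution\<close>

lemma unitary_rep_shift:
  fixes \<Phi> :: "'i \<Rightarrow> 'g::topological_group_add \<Rightarrow> real" and J :: "('i \<times> 'g \<Rightarrow> complex) \<Rightarrow> 'v"
  assumes \<Phi>: "\<And>i. normalized_pd (\<lambda>g. complex_of_real (\<Phi> i g))" and J: "inj J"
  defines "k \<equiv> sum_kernel \<Phi>"
  shows "unitary_rep (rkhs_hilbert J k) (\<lambda>g x. J (shift g (decode J k x)))"
proof -
  have pd: "pd_kernel k" unfolding k_def by (rule pd_sum_kernel[OF \<Phi>])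
  note [simp] = decode_J[OF J pd] decode_in[OF J pd] shift_in[where \<Phi> = \<Phi>, OF \<Phi>, folded k_def] rkhs_simps[OF J pd]
  define \<pi> where "\<pi> g x = J (shift g (decode J k x))" for g x
  have \<pi>\<pi>: "\<pi> (g + h) x = \<pi> g (\<pi> h x)" for g h x
    by (simp add: \<pi>_def shift_shift)
  have \<pi>_in: "\<pi> g x \<in> J ` rkhs k" for g x
    by (simp add: \<pi>_def)
  have \<pi>0: "\<pi> 0 x = x" if "x \<in> J ` rkhs k" for x
    using J_decode[OF J pd that] by (simp add: \<pi>_def)
  have "unitary_operator (rkhs_hilbert J k) (\<pi> g)" for g
    unfolding unitary_operator_def
  proof (intro conjI ballI allI)
    show "bij_betw (\<pi> g) (carrier (rkhs_hilbert J k)) (carrier (rkhs_hilbert J k))"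
    proof (rule bij_betw_byWitness[where f' = "\<pi> (- g)"])
      show "\<forall>x\<in>carrier (rkhs_hilbert J k). \<pi> (- g) (\<pi> g x) = x" "\<forall>x\<in>carrier (rkhs_hilbert J k). \<pi> g (\<pi> (- g) x) = x"
        using \<pi>0 by (simp_all flip: \<pi>\<pi>)
    qed (use \<pi>_in in auto)
    fix x y a
    show "\<pi> g (x \<oplus>\<^bsub>rkhs_hilbert J k\<^esub> y) = \<pi> g x \<oplus>\<^bsub>rkhs_hilbert J k\<^esub> \<pi> g y"
      "\<pi> g (a \<odot>\<^bsub>rkhs_hilbert J k\<^esub> x) = a \<odot>\<^bsub>rkhs_hilbert J k\<^esub> \<pi> g x"
      by (simp_all add: \<pi>_def) (simp_all add: shift_def o_def)
    show "hinner (rkhs_hilbert J k) (\<pi> g x) (\<pi> g y) = hinner (rkhs_hilbert J k) x y"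
      by (simp add: \<pi>_def rkhs_inner_shift[where \<Phi> = \<Phi>, OF \<Phi>, folded k_def])
  qed
  moreover have "continuous_map euclidean (htopology (rkhs_hilbert J k)) (\<lambda>g. \<pi> g x)" for x
    unfolding htopology_def Metric_space.continuous_map_to_metric[OF Metric_space_rkhs_hilbert[OF J pd]]
  proof (intro ballI allI impI)
    fix g0 :: 'g and r :: real
    assume "r > 0"
    have "\<forall>\<^sub>F g in nhds g0. rkhs_norm k (\<lambda>z. shift g (decode J k x) z - shift g0 (decode J k x) z) < r"
      unfolding k_def by (rule shift_continuous[OF \<Phi> _ \<open>r > 0\<close>]) (simp flip: k_def)
    then obtain U where U: "open U" "g0 \<in> U"
      "\<And>g. g \<in> U \<Longrightarrow> rkhs_norm k (\<lambda>z. shift g (decode J k x) z - shift g0 (decode J k x) z) < r"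
      unfolding eventually_nhds by blast
    have "hdist (rkhs_hilbert J k) (\<pi> g0 x) (\<pi> g x) < r" if "g \<in> U" for g
      using U(3)[OF that] Metric_space.commute[OF Metric_space_rkhs_hilbert[OF J pd], of "\<pi> g0 x" "\<pi> g x"]
      by (simp add: hdist_rkhs_hilbert[OF J pd] \<pi>_def)
    then show "\<exists>U. openin euclidean U \<and> g0 \<in> U \<and>
        (\<forall>g\<in>U. \<pi> g x \<in> Metric_space.mball (carrier (rkhs_hilbert J k)) (hdist (rkhs_hilbert J k)) (\<pi> g0 x) r)"
      unfolding Metric_space.in_mball[OF Metric_space_rkhs_hilbert[OF J pd]]
      using U(1,2) \<pi>_in by (intro exI[of _ U]) simp
  qed
  ultimately have "unitary_rep (rkhs_hilbert J k) \<pi>"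
    using hilbert_space_rkhs_hilbert[OF J pd] \<pi>\<pi> by (simp add: unitary_rep_def)
  then show ?thesis by (simp add: \<pi>_def[abs_def])
qed

text \<open>The cyclic vector of the summand \<open>i\<close> is a unit vector, moved by
  \<open>g\<close> to squared distance \<open>2 - 2 * \<Phi> i g\<close>; a deviation of at most
  \<open>\<epsilon>\<^sup>2 / 2\<close> on \<open>K\<close> therefore suffices.\<close>

lemma almost_invariant_shift:
  fixes \<Phi> :: "'i \<Rightarrow> 'g::topological_group_add \<Rightarrow> real" and J :: "('i \<times> 'g \<Rightarrow> complex) \<Rightarrow> 'v"
  assumes \<Phi>: "\<And>i. normalized_pd (\<lambda>g. complex_of_real (\<Phi> i g))" and J: "inj J"
    and near: "\<And>K \<epsilon>. compact K \<Longrightarrow> \<epsilon> > 0 \<Longrightarrow> \<exists>i. \<forall>g\<in>K. 1 - \<Phi> i g \<le> \<epsilon>"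
  defines "k \<equiv> sum_kernel \<Phi>"
  shows "almost_has_invariant_vectors (rkhs_hilbert J k) (\<lambda>g x. J (shift g (decode J k x)))"
  unfolding almost_has_invariant_vectors_def
proof (intro allI impI)
  fix K :: "'g set" and \<epsilon> :: real
  assume K: "compact K" "\<epsilon> > 0"
  have pd: "pd_kernel k" unfolding k_def by (rule pd_sum_kernel[OF \<Phi>])
  note [simp] = decode_J[OF J pd] decode_in[OF J pd] shift_in[where \<Phi> = \<Phi>, OF \<Phi>, folded k_def] rkhs_simps[OF J pd]
    comb_in_rkhs[OF pd] J_eq[OF J pd]
  obtain i where i: "\<And>g. g \<in> K \<Longrightarrow> 1 - \<Phi> i g \<le> \<epsilon>\<^sup>2 / 2"
    using near[OF K(1), of "\<epsilon>\<^sup>2 / 2"] K(2) by auto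
  have pd_i: "pd_fun (\<lambda>g. complex_of_real (\<Phi> i g))" "\<Phi> i 0 = 1"
    using \<Phi>[of i] by (auto simp: normalized_pd_def positive_definite_iff_pd_fun)
  define F where "F = comb k [(1, (i, 0))]"
  have F: "F \<in> rkhs k" "rkhs_norm k F = 1"
    by (simp_all add: F_def rkhs_norm_comb[OF pd] form_norm_def) (simp add: k_def sum_kernel_def pd_i)
  have sF: "shift g F = comb k [(1, (i, g))]" for g
  proof
    fix z :: "'i \<times> 'g"
    show "shift g F z = comb k [(1, (i, g))] z"
      using sum_kernel_translate[of \<Phi> "- g" "(i, g)" z] by (simp add: F_def shift_def comb_def k_def)
  qed
  have "rkhs_norm k (\<lambda>z. shift g F z - F z) \<le> \<epsilon>" if "g \<in> K" for g
  proof -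
    have "(\<lambda>z. shift g F z - F z) = comb k [(1, (i, g)), (-1, (i, 0))]"
      by (simp only: sF) (simp add: F_def comb_def fun_eq_iff)
    then have "rkhs_norm k (\<lambda>z. shift g F z - F z) = form_norm k [(1, (i, g)), (-1, (i, 0))]"
      by (simp add: rkhs_norm_comb[OF pd])
    also have "form k [(1, (i, g)), (-1, (i, 0))] [(1, (i, g)), (-1, (i, 0))] =
        form (\<lambda>g h. complex_of_real (\<Phi> i (- h + g))) [(1, g), (-1, 0)] [(1, g), (-1, 0)]"
      by (simp add: form_def k_def sum_kernel_def)
    then have "form_norm k [(1, (i, g)), (-1, (i, 0))] = sqrt (2 - 2 * \<Phi> i g)"
      using pd_fun_form_diff[OF pd_i(1), of g 0] pd_i(2) by (simp add: form_norm_def)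
    also have "\<dots> \<le> \<epsilon>"
      using i[OF that] K(2) by (intro real_le_lsqrt) auto
    finally show ?thesis .
  qed
  then have "\<forall>g\<in>K. hnorm (rkhs_hilbert J k) (J (shift g (decode J k (J F))) \<ominus>\<^bsub>rkhs_hilbert J k\<^esub> J F) \<le> \<epsilon> * hnorm (rkhs_hilbert J k) (J F)"
    using F by (simp add: a_minus_rkhs_hilbert[OF J pd] hnorm_rkhs_hilbert[OF J pd])
  moreover have "J F \<noteq> \<zero>\<^bsub>rkhs_hilbert J k\<^esub>"
  proof
    assume "J F = \<zero>\<^bsub>rkhs_hilbert J k\<^esub>"
    then have "F = (\<lambda>z. 0)" by simp
    then have "F (i, 0) = 0" by simp
    then show False by (simp add: F_def comb_def k_def sum_kernel_def pd_i)
  qed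
  ultimately show "\<exists>\<xi>\<in>carrier (rkhs_hilbert J k). \<xi> \<noteq> \<zero>\<^bsub>rkhs_hilbert J k\<^esub> \<and>
      (\<forall>g\<in>K. hnorm (rkhs_hilbert J k) (J (shift g (decode J k \<xi>)) \<ominus>\<^bsub>rkhs_hilbert J k\<^esub> \<xi>) \<le> \<epsilon> * hnorm (rkhs_hilbert J k) \<xi>)"
    using F(1) by (intro bexI[of _ "J F"]) auto
qed

text \<open>Only almost invariance of the factored representation is used, never its continuity: on the
  smaller carrier \<open>hdist\<close> is in general not symmetric outside the carrier, so that nothing is
  known about \<open>htopology\<close> there.\<close>

lemma resolution_invariant_vector:
  fixes \<Phi> :: "'i \<Rightarrow> 'g::topological_group_add \<Rightarrow> real" and J :: "('i \<times> 'g \<Rightarrow> complex) \<Rightarrow> 'v"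
    and f :: "'g \<Rightarrow> 'q::topological_group_add"
  assumes \<Phi>: "\<And>i. normalized_pd (\<lambda>g. complex_of_real (\<Phi> i g))" and J: "inj J"
    and near: "\<And>K \<epsilon>. compact K \<Longrightarrow> \<epsilon> > 0 \<Longrightarrow> \<exists>i. \<forall>g\<in>K. 1 - \<Phi> i g \<le> \<epsilon>"
    and f: "resolution TYPE('v) f" and L: "compact L"
  obtains F where "F \<in> rkhs (sum_kernel \<Phi>)" "F \<noteq> (\<lambda>z. 0)"
    "\<And>x. f x \<in> L \<Longrightarrow> rkhs_norm (sum_kernel \<Phi>) (\<lambda>z. shift x F z - F z) \<le> rkhs_norm (sum_kernel \<Phi>) F"
proof -
  let ?k = "sum_kernel \<Phi>"
  let ?H = "rkhs_hilbert J ?k"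
  have pd: "pd_kernel ?k" by (rule pd_sum_kernel[OF \<Phi>])
  note [simp] = decode_J[OF J pd] decode_in[OF J pd] shift_in[where \<Phi> = \<Phi>, OF \<Phi>] rkhs_simps[OF J pd] J_eq[OF J pd]
  define \<pi> where "\<pi> = (\<lambda>g x. J (shift g (decode J ?k x)))"
  have "unitary_rep ?H \<pi>" "almost_has_invariant_vectors ?H \<pi>"
    unfolding \<pi>_def by (rule unitary_rep_shift[OF \<Phi> J], rule almost_invariant_shift[OF \<Phi> J near])
  then obtain V \<rho> where V: "subrepresentation ?H \<pi> V"
    and \<rho>: "almost_has_invariant_vectors (?H\<lparr>carrier := V\<rparr>) \<rho>" "\<And>g x. x \<in> V \<Longrightarrow> \<pi> g x = \<rho> (f g) x"
    using f unfolding resolution_def by blast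
  have sub: "submodule V complex_ring ?H" using V by (simp add: subrepresentation_def)
  interpret M: module complex_ring ?H
    using hilbert_space_rkhs_hilbert[OF J pd] by (rule hilbert_space.axioms)
  have VJ: "V \<subseteq> J ` rkhs ?k" using M.submoduleE(1)[OF sub] by simp
  \<comment> \<open>Almost invariance on the compact set \<open>L\<close> is used with
    \<open>\<epsilon> = 1\<close>; factoring through \<open>f\<close> turns it into a bound for all
    \<open>x\<close> with \<open>f x \<in> L\<close>.\<close>
  obtain v where v: "v \<in> V" "v \<noteq> J (\<lambda>z. 0)"
    "\<And>q. q \<in> L \<Longrightarrow> hnorm (?H\<lparr>carrier := V\<rparr>) (\<rho> q v \<ominus>\<^bsub>?H\<lparr>carrier := V\<rparr>\<^esub> v) \<le> 1 * hnorm (?H\<lparr>carrier := V\<rparr>) v"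
    using \<rho>(1)[unfolded almost_has_invariant_vectors_def, rule_format, OF L, of 1] by auto
  define F where "F = decode J ?k v"
  have vF: "v = J F" using J_decode[OF J pd] VJ v(1) by (auto simp: F_def)
  \<comment> \<open>Membership of the negative in \<open>V\<close> lets \<open>a_minus\<close> on
    the smaller carrier be computed as the pointwise difference.\<close>
  have neg: "J (\<lambda>z. - decode J ?k v z) \<in> V"
    using M.submoduleE(4)[OF sub _ v(1), of "-1"] by (simp add: complex_ring_def)
  have hn: "hnorm (?H\<lparr>carrier := V\<rparr>) x = rkhs_norm ?k (decode J ?k x)" for x
    by (simp add: hnorm_def rkhs_norm_def)
  show thesis
  proof (rule that[of F])
    show "F \<in> rkhs ?k" by (simp add: F_def)
    show "F \<noteq> (\<lambda>z. 0)" using v(2) vF by auto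
    fix x
    assume "f x \<in> L"
    from v(3)[OF this] show "rkhs_norm ?k (\<lambda>z. shift x F z - F z) \<le> rkhs_norm ?k F"
      unfolding \<rho>(2)[OF v(1), symmetric] hn a_minus_sub[OF J pd VJ neg]
      by (simp add: \<pi>_def F_def)
  qed
qed

lemma relative_property_T_if_compact_closure_image:
  fixes f :: "'g::topological_group_add \<Rightarrow> 'q::topological_group_add"
  assumes G: "locally_compact_space (euclidean :: 'g topology)"
    and Q: "locally_compact_space (euclidean :: 'q topology)"
    and large: "large_for TYPE('v) TYPE('g)"
    and res: "resolution TYPE('v) f"
    and X: "compact (closure (f ` X))"
  shows "relative_property_T X"
proof (rule ccontr)
  assume nX: "\<not> relative_property_T X"
  have f: "morphism f" using res by (simp add: resolution_def)
  obtain U :: "'g set" where U: "compact U" "0 \<in> interior U"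
    using locally_compact_nhd_0[OF G] by blast
  obtain L :: "'q set" where L: "compact L" "0 \<in> interior L"
    using locally_compact_nhd_0[OF Q] by blast
  obtain j :: "('g set \<Rightarrow> nat \<Rightarrow> 'g \<Rightarrow> complex) \<Rightarrow> 'v" where j: "inj j"
    using large by (auto simp: large_for_def)
  \<comment> \<open>The summands are indexed by pairs of a set and a number; currying fits functions
    on index and group element to the type in \<open>large_for\<close>.\<close>
  define J :: "(('g set \<times> nat) \<times> 'g \<Rightarrow> complex) \<Rightarrow> 'v" where "J F = j (\<lambda>A n g. F ((A, n), g))" for F
  have J: "inj J"
    by (rule injI) (auto simp: J_def fun_eq_iff dest!: injD[OF j])
  \<comment> \<open>The index runs over all pairs of a set and a tolerance. If the set is not
    compact, the empty set takes its place and the closeness condition is void.\<close>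
  have "\<exists>\<Phi> B. normalized_pd (\<lambda>g. complex_of_real (\<Phi> g)) \<and> (compact (fst i) \<longrightarrow> (\<forall>g\<in>fst i. 1 - \<Phi> g \<le> 1 / Suc (snd i))) \<and>
      (\<forall>g. 0 \<le> \<Phi> g) \<and> length_balls B \<and> (\<forall>g M. g \<notin> B M \<longrightarrow> \<Phi> g \<le> exp (- M)) \<and> (\<forall>M. \<not> X \<inter> \<Union>(range B) \<subseteq> B M)"
    for i :: "'g set \<times> nat"
  proof -
    have "compact (if compact (fst i) then fst i else {})" "1 / real (Suc (snd i)) > 0" by auto
    from not_relative_property_T_profile[OF U nX this] obtain \<Phi> :: "'g \<Rightarrow> real" and B where
      "normalized_pd (\<lambda>g. complex_of_real (\<Phi> g))"
      "\<And>g. g \<in> (if compact (fst i) then fst i else {}) \<Longrightarrow> 1 - \<Phi> g \<le> 1 / real (Suc (snd i))" "\<And>g. 0 \<le> \<Phi> g"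
      "length_balls B" "\<And>g M. g \<notin> B M \<Longrightarrow> \<Phi> g \<le> exp (- M)" "\<And>M. \<not> X \<inter> \<Union>(range B) \<subseteq> B M"
      by blast
    then show ?thesis by (intro exI[of _ \<Phi>] exI[of _ B]) auto
  qed
  then obtain \<Phi> :: "'g set \<times> nat \<Rightarrow> 'g \<Rightarrow> real" and B where
    \<Phi>: "\<And>i. normalized_pd (\<lambda>g. complex_of_real (\<Phi> i g))"
      "\<And>i. compact (fst i) \<Longrightarrow> \<forall>g\<in>fst i. 1 - \<Phi> i g \<le> 1 / Suc (snd i)" "\<And>i g. 0 \<le> \<Phi> i g"
    and B: "\<And>i. length_balls (B i)" "\<And>i g M. g \<notin> B i M \<Longrightarrow> \<Phi> i g \<le> exp (- M)"
      "\<And>i M. \<not> X \<inter> \<Union>(range (B i)) \<subseteq> B i M"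
    by metis
  have near: "\<exists>i. \<forall>g\<in>K. 1 - \<Phi> i g \<le> \<epsilon>" if K: "compact K" "\<epsilon> > 0" for K \<epsilon>
  proof -
    obtain n where "1 / real (Suc n) < \<epsilon>" using nat_approx_posE[OF K(2)] by (auto simp: inverse_eq_divide)
    then show ?thesis using \<Phi>(2)[of "(K, n)"] K(1) by (intro exI[of _ "(K, n)"]) force
  qed
  obtain F where F: "F \<in> rkhs (sum_kernel \<Phi>)" "F \<noteq> (\<lambda>z. 0)"
    "\<And>x. f x \<in> L \<Longrightarrow> rkhs_norm (sum_kernel \<Phi>) (\<lambda>z. shift x F z - F z) \<le> rkhs_norm (sum_kernel \<Phi>) F"
    using resolution_invariant_vector[OF \<Phi>(1) J near res L(1)] by blast
  \<comment> \<open>The balls conjugated by \<open>h\<close> arise from the translated cyclic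
    vectors. They are again length balls, and inverse images of identity neighbourhoods contain
    elements of arbitrarily large finite length for each of them.\<close>
  define C where "C = (\<lambda>(i, h) M. {x. - h + x + h \<in> B i M})"
  define \<N> where "\<N> = (\<lambda>W. f -` W) ` {W. open W \<and> 0 \<in> W}"
  have "\<not> f -` L \<subseteq> (\<Union>(c, (i, h), M)\<in>T. (+) c ` {x. - h + x + h \<in> B i M})" if T: "finite T" for T
  proof -
    \<comment> \<open>The family \<open>\<N>\<close> consists of inverse images of open sets, so the
      interior of \<open>L\<close> is treated first.\<close>
    have "\<not> f -` interior L \<subseteq> (\<Union>(c, s, M)\<in>T. (+) c ` C s M)"
    proof (rule not_covered_by_translates[where \<N> = \<N> and S = "(fst \<circ> snd) ` T"])
      show "0 \<in> N" if "N \<in> \<N>" for N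
        using that morphismD(3)[OF f] by (auto simp: \<N>_def)
      show "\<exists>N'\<in>\<N>. \<forall>a\<in>N'. \<forall>b\<in>N'. a + b \<in> N \<and> - a + b \<in> N" if N: "N \<in> \<N>" for N
      proof -
        obtain W where W: "N = f -` W" "open W" "0 \<in> W" using N by (auto simp: \<N>_def)
        obtain W' where W': "open W'" "0 \<in> W'" "\<And>a b. a \<in> W' \<Longrightarrow> b \<in> W' \<Longrightarrow> a + b \<in> W \<and> - a + b \<in> W"
          using nhd_0_add_diff[OF W(2,3)] by blast
        show ?thesis
          using W' by (intro bexI[of _ "f -` W'"]) (auto simp: W(1) morphismD[OF f] \<N>_def)
      qed
      show "length_balls (C s)" for s
      proof -
        obtain i h where s: "s = (i, h)" by (cases s)
        have "- h + (- x + y) + h = - (- h + x + h) + (- h + y + h)" for x y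
          by (simp add: minus_add add.assoc del: add_uminus_conv_diff)
        then show ?thesis
          using length_ballsD[OF B(1)[of i]] unfolding length_balls_def C_def s by (auto intro!: monoI)
      qed
      show "\<not> N \<inter> \<Union>(range (C s)) \<subseteq> C s M" if "N \<in> \<N>" for s N M
        using that unbounded_near_kernel[OF f X B(1) B(3)] by (cases s) (auto simp: C_def \<N>_def)
      show "f -` interior L \<in> \<N>" using L(2) by (auto simp: \<N>_def)
      show "s \<in> (fst \<circ> snd) ` T" if "(c, s, M) \<in> T" for c s M
        using that by force
    qed (use T in auto)
    moreover have "f -` interior L \<subseteq> f -` L" using interior_subset by auto
    ultimately have "\<not> f -` L \<subseteq> (\<Union>(c, s, M)\<in>T. (+) c ` C s M)"
      by (rule contrapos_nn[OF _ order_trans])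
    moreover have "(\<lambda>(c, s, M). (+) c ` C s M) = (\<lambda>(c, (i, h), M). (+) c ` {x. - h + x + h \<in> B i M})"
      by (simp add: C_def case_prod_unfold)
    ultimately show ?thesis by (simp only: not_False_eq_True)
  qed
  from moved_vector[where \<Phi> = \<Phi> and B = B, OF \<Phi>(1) B(2) \<Phi>(3) this F(1,2)]
  obtain x where x: "x \<in> f -` L" "rkhs_norm (sum_kernel \<Phi>) F < rkhs_norm (sum_kernel \<Phi>) (\<lambda>z. shift x F z - F z)" .
  then show False using F(3)[of x] by simp
qed

theorem corollary4p2p7:
  fixes f :: "'g::{topological_group_add, t2_space} \<Rightarrow> 'q::{topological_group_add, t2_space}"
  assumes "locally_compact_space (euclidean :: 'g topology)"
    and "locally_compact_space (euclidean :: 'q topology)"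
    and "large_for TYPE('v) TYPE('g)"
    and "haagerup_resolution TYPE('v) f"
  shows "(\<forall>X :: 'g set. relative_property_T X \<longleftrightarrow> compact (closure (f ` X))) \<and>
    (proper_morphism f \<or> (\<exists>X :: 'g set. closed X \<and> \<not> compact X \<and> relative_property_T X)) \<and>
    (proper_morphism f \<longrightarrow> haagerup TYPE('g)) \<and>
    TH_alternative TYPE('g)"
proof -
  have res: "resolution TYPE('v) f" and Q: "haagerup TYPE('q)"
    using assms(4) by (auto simp: haagerup_resolution_def)
  have f: "morphism f" using res by (simp add: resolution_def)
  have iff: "relative_property_T X \<longleftrightarrow> compact (closure (f ` X))" for X :: "'g set"
    using compact_closure_image_if_relative_property_T[OF f Q]
      relative_property_T_if_compact_closure_image[OF assms(1-3) res] by blast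
  \<comment> \<open>The inverse image of a compact set that violates properness serves as
    \<open>X\<close>: it is closed, and its image stays inside that compact set.\<close>
  have alt: "\<exists>X :: 'g set. closed X \<and> \<not> compact X \<and> relative_property_T X" if np: "\<not> proper_morphism f"
  proof -
    obtain K where K: "compact K" "\<not> compact (f -` K)"
      using np f by (auto simp: proper_morphism_def)
    have "closed (f -` K)"
      using K(1) morphismD(1)[OF f] by (intro closed_vimage compact_imp_closed)
    moreover have "closure (f ` (f -` K)) \<subseteq> K"
      using compact_imp_closed[OF K(1)] by (intro closure_minimal) auto
    then have "compact (closure (f ` (f -` K)))"
      using compact_Int_closed[OF K(1) closed_closure, of "f ` (f -` K)"] by (simp add: Int_absorb1)
    ultimately show ?thesis using K(2) iff by blast
  qed
  have hg: "proper_morphism f \<longrightarrow> haagerup TYPE('g)"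
    using haagerup_if_proper Q by blast
  have "TH_alternative TYPE('g)"
    using alt hg unfolding TH_alternative_def by (metis closure_closed)
  with iff alt hg show ?thesis by blast
qed

end
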